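(* Let $F$ be a subfield of $\mathbb{R}$. Let $S\subseteq\mathbb{R}^n$ ($n\ge1$) be an $F$-rational polyhedral subset. Let $f: S \cap F^n \to \mathbb{R}$ be a function such that for every $F$-rational line $L\subseteq \mathbb{R}^n$, the restriction of $f$ to $S\cap F^n\cap L$ is $F$-integral polyhedral. Then $f$ is $F$-integral polyhedral.
   Context: An affine functional $\lambda(x_1,\dots,x_n)=a_1x_1+\cdots+a_nx_n+b$ on $\mathbb{R}^n$ is $F$-integral if $a_1,\dots,a_n\in\mathbb{Z}$ and $b\in F$. An $F$-rational polyhedral subset of $\mathbb{R}^n$ is an intersection of finitely many (possibly zero) closed halfspaces $\{x:\lambda(x)\ge 0\}$ with each $\lambda$ an $F$-integral affine functional with $(a_1,\dots,a_n)\neq 0$ (it need not be bounded). An $F$-rational line is an affine line in $\mathbb{R}^n$ that is an $F$-rational polyhedral subset. For any $T\subseteq\mathbb{R}^n$, a function $g:T\to\mathbb{R}$ is $F$-integral polyhedral if $g(x)=\max\{\lambda_1(x),\dots,\lambda_m(x)\}$ for all $x\in T$, for some finite list of $F$-integral affine functionals $\lambda_1,\dots,\lambda_m$ on $\mathbb{R}^n$. *)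

theory Defs
  imports "HOL-Analysis.Analysis"
begin

definition real_subfield :: "real set \<Rightarrow> bool" where
  "real_subfield F \<longleftrightarrow> 0 \<in> F \<and> 1 \<in> F \<and>
     (\<forall>x\<in>F. \<forall>y\<in>F. x + y \<in> F) \<and> (\<forall>x\<in>F. - x \<in> F) \<and>
     (\<forall>x\<in>F. \<forall>y\<in>F. x * y \<in> F) \<and> (\<forall>x\<in>F. x \<noteq> 0 \<longrightarrow> inverse x \<in> F)"

definition rational_points :: "real set \<Rightarrow> (real ^ 'n) set" where
  "rational_points F = {x. \<forall>i. x $ i \<in> F}"

definition F_integral_affine :: "real set \<Rightarrow> (real ^ 'n \<Rightarrow> real) \<Rightarrow> bool" where
  "F_integral_affine F l \<longleftrightarrow>
     (\<exists>a b. (\<forall>i. a $ i \<in> \<int>) \<and> b \<in> F \<and> l = (\<lambda>x. a \<bullet> x + b))"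

definition F_rational_halfspace :: "real set \<Rightarrow> (real ^ 'n) set \<Rightarrow> bool" where
  "F_rational_halfspace F h \<longleftrightarrow>
     (\<exists>a b. (\<forall>i. a $ i \<in> \<int>) \<and> a \<noteq> 0 \<and> b \<in> F \<and> h = {x. a \<bullet> x + b \<ge> 0})"

text \<open>The family of halfspaces may be empty, in which case the intersection is the whole space.\<close>

definition F_rational_polyhedral :: "real set \<Rightarrow> (real ^ 'n) set \<Rightarrow> bool" where
  "F_rational_polyhedral F S \<longleftrightarrow>
     (\<exists>H. finite H \<and> (\<forall>h\<in>H. F_rational_halfspace F h) \<and> S = \<Inter>H)"

definition F_rational_line :: "real set \<Rightarrow> (real ^ 'n) set \<Rightarrow> bool" where
  "F_rational_line F L \<longleftrightarrow> affine L \<and> aff_dim L = 1 \<and> F_rational_polyhedral F L"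

text \<open>A function on a subset \<open>T\<close> is a total function of which only the values on \<open>T\<close> matter.
  The set of functionals is nonempty, as \<^const>\<open>Max\<close> is unspecified on the empty set.\<close>

definition F_integral_polyhedral_on ::
    "real set \<Rightarrow> (real ^ 'n) set \<Rightarrow> (real ^ 'n \<Rightarrow> real) \<Rightarrow> bool" where
  "F_integral_polyhedral_on F T g \<longleftrightarrow>
     (\<exists>\<Lambda>. finite \<Lambda> \<and> \<Lambda> \<noteq> {} \<and> (\<forall>l\<in>\<Lambda>. F_integral_affine F l) \<and>
        (\<forall>x\<in>T. g x = Max ((\<lambda>l. l x) ` \<Lambda>)))"

end

(*
  On every line the function is convex and piecewise affine with integral slopes. It suffices to bound
  the slopes at interior points: the points where f is smooth along all coordinate axes are dense, at
  such a point the integral gradient defines an affine functional below f, only finitely many gradients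
  occur, and a gradient determines its functional; f is the maximum of these functionals.

  The slopes are bounded by induction on the number of inequalities. In a recession direction v of S, the
  final slope of f along x + t v does not depend on the interior point x. In any other direction the line
  leaves S through a facet, on which f is polyhedral by induction; on each cell where f is affine the exit
  slope is an integer-valued convex function, hence constant in the interior of the cell and no smaller on its boundary.
*)
theory Submission
  imports Defs
begin

definition halfspaces_inter :: "((real ^ 'n) \<times> real) set \<Rightarrow> (real ^ 'n) set" where
  "halfspaces_inter I = {x. \<forall>(a, b)\<in>I. a \<bullet> x + b \<ge> 0}"

definition open_halfspaces_inter :: "((real ^ 'n) \<times> real) set \<Rightarrow> (real ^ 'n) set" where
  "open_halfspaces_inter I = {x. \<forall>(a, b)\<in>I. a \<bullet> x + b > 0}"

abbreviation int_vecs :: "(real ^ 'n) set" where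
  "int_vecs \<equiv> rational_points \<int>"

locale subfield_of_reals =
  fixes F :: "real set"
  assumes subfield: "real_subfield F"
begin

abbreviation F_vecs :: "(real ^ 'n) set" where
  "F_vecs \<equiv> rational_points F"

definition integral_system :: "((real ^ 'n) \<times> real) set \<Rightarrow> bool" where
  "integral_system I \<longleftrightarrow> finite I \<and> I \<subseteq> int_vecs \<times> F"

lemma F_zero [simp]: "0 \<in> F" and F_one [simp]: "1 \<in> F"
  and F_add: "x \<in> F \<Longrightarrow> y \<in> F \<Longrightarrow> x + y \<in> F"
  and F_uminus: "x \<in> F \<Longrightarrow> - x \<in> F"
  and F_mult: "x \<in> F \<Longrightarrow> y \<in> F \<Longrightarrow> x * y \<in> F"
  using subfield unfolding real_subfield_def by auto

lemma F_inverse: "x \<in> F \<Longrightarrow> inverse x \<in> F"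
  using subfield unfolding real_subfield_def by (cases "x = 0") auto

lemma F_diff: "x \<in> F \<Longrightarrow> y \<in> F \<Longrightarrow> x - y \<in> F"
  using F_add[of x "- y"] F_uminus[of y] by simp

lemma F_divide: "x \<in> F \<Longrightarrow> y \<in> F \<Longrightarrow> x / y \<in> F"
  unfolding divide_inverse by (intro F_mult F_inverse)

lemma F_of_nat [simp]: "of_nat n \<in> F"
  by (induction n) (auto intro: F_add)

lemma F_of_int [simp]: "of_int n \<in> F"
  by (cases n) (auto intro: F_uminus F_diff simp del: of_nat_Suc)

lemma F_numeral [simp]: "numeral n \<in> F"
  using F_of_nat[of "numeral n"] by simp

lemma Ints_subset_F: "x \<in> \<int> \<Longrightarrow> x \<in> F"
  by (auto elim: Ints_cases)

lemma F_sum: "(\<And>i. i \<in> A \<Longrightarrow> g i \<in> F) \<Longrightarrow> sum g A \<in> F"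
  by (induction A rule: infinite_finite_induct) (auto intro: F_add)

lemmas F_intros = F_add F_uminus F_mult F_inverse F_diff F_divide F_sum

lemma int_vecs_subset: "v \<in> int_vecs \<Longrightarrow> v \<in> F_vecs"
  by (auto simp: rational_points_def Ints_subset_F)

lemma F_vecs_add: "x \<in> F_vecs \<Longrightarrow> y \<in> F_vecs \<Longrightarrow> x + y \<in> F_vecs"
  by (auto simp: rational_points_def intro: F_intros)

lemma F_vecs_diff: "x \<in> F_vecs \<Longrightarrow> y \<in> F_vecs \<Longrightarrow> x - y \<in> F_vecs"
  by (auto simp: rational_points_def intro: F_intros)

lemma F_vecs_scaleR: "t \<in> F \<Longrightarrow> x \<in> F_vecs \<Longrightarrow> t *\<^sub>R x \<in> F_vecs"
  by (auto simp: rational_points_def intro: F_intros)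

lemma F_vecs_shift: "x \<in> F_vecs \<Longrightarrow> t \<in> F \<Longrightarrow> v \<in> int_vecs \<Longrightarrow> x + t *\<^sub>R v \<in> F_vecs"
  by (simp add: F_vecs_add F_vecs_scaleR int_vecs_subset)

lemma F_inner: "a \<in> F_vecs \<Longrightarrow> x \<in> F_vecs \<Longrightarrow> a \<bullet> x \<in> F"
  by (auto simp: rational_points_def inner_vec_def intro!: F_intros)

end

lemma int_vecs_add: "x \<in> int_vecs \<Longrightarrow> y \<in> int_vecs \<Longrightarrow> x + y \<in> int_vecs"
  by (auto simp: rational_points_def)

lemma int_vecs_diff: "x \<in> int_vecs \<Longrightarrow> y \<in> int_vecs \<Longrightarrow> x - y \<in> int_vecs"
  by (auto simp: rational_points_def)

lemma int_vecs_uminus: "x \<in> int_vecs \<Longrightarrow> - x \<in> int_vecs"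
  by (auto simp: rational_points_def)

lemma int_vecs_scaleR: "t \<in> \<int> \<Longrightarrow> x \<in> int_vecs \<Longrightarrow> t *\<^sub>R x \<in> int_vecs"
  by (auto simp: rational_points_def)

lemma int_vecs_zero: "0 \<in> int_vecs"
  by (auto simp: rational_points_def)

lemma int_vecs_axis: "axis i 1 \<in> int_vecs"
  by (auto simp: rational_points_def axis_def)

lemma int_vecs_inner: "a \<in> int_vecs \<Longrightarrow> x \<in> int_vecs \<Longrightarrow> a \<bullet> x \<in> \<int>"
  by (auto simp: rational_points_def inner_vec_def)

lemmas int_vecs_intros =
  int_vecs_add int_vecs_diff int_vecs_uminus int_vecs_scaleR int_vecs_zero int_vecs_axis

lemma halfspaces_inter_convex: "convex (halfspaces_inter I)"
proof -
  have "halfspaces_inter I = (\<Inter>(a, b)\<in>I. {x. a \<bullet> x \<ge> - b})"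
    by (force simp: halfspaces_inter_def)
  then show ?thesis
    by (auto intro!: convex_INT convex_halfspace_ge)
qed

lemma open_halfspaces_inter_convex: "convex (open_halfspaces_inter I)"
proof -
  have "open_halfspaces_inter I = (\<Inter>(a, b)\<in>I. {x. a \<bullet> x > - b})"
    by (force simp: open_halfspaces_inter_def)
  then show ?thesis
    by (auto intro!: convex_INT convex_halfspace_gt)
qed

lemma open_halfspaces_inter_open:
  assumes "finite I" shows "open (open_halfspaces_inter I)"
proof -
  have "open_halfspaces_inter I = (\<Inter>(a, b)\<in>I. {x. a \<bullet> x > - b})"
    by (force simp: open_halfspaces_inter_def)
  with assms show ?thesis
    by (auto intro!: open_INT open_halfspace_gt)
qed

lemma open_halfspaces_inter_subset: "open_halfspaces_inter I \<subseteq> halfspaces_inter I"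
  by (force simp: halfspaces_inter_def open_halfspaces_inter_def)

lemma halfspaces_inter_segment:
  assumes "z \<in> halfspaces_inter I" "y \<in> open_halfspaces_inter I" "0 < s" "s \<le> 1"
  shows "(1 - s) *\<^sub>R z + s *\<^sub>R y \<in> open_halfspaces_inter I"
  unfolding open_halfspaces_inter_def
proof (clarsimp simp only: mem_Collect_eq split: prod.split)
  fix a b assume ab: "(a, b) \<in> I"
  then have "a \<bullet> z + b \<ge> 0" "a \<bullet> y + b > 0"
    using assms by (auto simp: halfspaces_inter_def open_halfspaces_inter_def)
  then have "(1 - s) * (a \<bullet> z + b) + s * (a \<bullet> y + b) > 0"
    using assms by (simp add: add_nonneg_pos)
  then show "a \<bullet> ((1 - s) *\<^sub>R z + s *\<^sub>R y) + b > 0"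
    by (simp add: inner_add_right algebra_simps)
qed

lemma implicit_equality:
  assumes "finite I" "convex U" "open_halfspaces_inter I \<inter> U = {}" "halfspaces_inter I \<inter> U \<noteq> {}"
  shows "\<exists>(a, b)\<in>I. \<forall>x\<in>halfspaces_inter I \<inter> U. a \<bullet> x + b = 0"
proof (rule ccontr)
  assume neg: "\<not> ?thesis"
  have "\<exists>x\<in>halfspaces_inter I \<inter> U. x \<in> open_halfspaces_inter K" if "finite K" "K \<subseteq> I" for K
    using that
  proof (induction K rule: finite_induct)
    case empty
    then show ?case using assms(4) by (auto simp: open_halfspaces_inter_def)
  next
    case (insert c K)
    obtain a b where c: "c = (a, b)" by (cases c)
    obtain x where x: "x \<in> halfspaces_inter I \<inter> U" "x \<in> open_halfspaces_inter K"
      using insert by auto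
    obtain y where y: "y \<in> halfspaces_inter I \<inter> U" "a \<bullet> y + b \<noteq> 0"
      using neg insert.prems c by blast
    have ypos: "a' \<bullet> y + b' \<ge> 0" and xpos: "a' \<bullet> x + b' \<ge> 0" if "(a', b') \<in> I" for a' b'
      using y x that by (auto simp: halfspaces_inter_def)
    define m where "m = (1 / 2) *\<^sub>R x + (1 / 2) *\<^sub>R y"
    have m: "m \<in> halfspaces_inter I \<inter> U"
      unfolding m_def using x y assms(2) halfspaces_inter_convex[of I]
      by (intro convexD convex_Int) auto
    have val: "a' \<bullet> m + b' = ((a' \<bullet> x + b') + (a' \<bullet> y + b')) / 2" for a' b'
      by (simp add: m_def inner_add_right field_simps)
    have "a' \<bullet> m + b' > 0" if ab: "(a', b') \<in> insert c K" for a' b'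
    proof (cases "(a', b') \<in> K")
      case True
      then have "a' \<bullet> x + b' > 0" using x by (auto simp: open_halfspaces_inter_def)
      moreover have "a' \<bullet> y + b' \<ge> 0" using True insert.prems by (intro ypos) auto
      ultimately show ?thesis unfolding val by simp
    next
      case False
      then have "(a', b') = (a, b)" using ab c by auto
      moreover have "a \<bullet> y + b \<ge> 0" "a \<bullet> x + b \<ge> 0"
        using insert.prems c by (auto intro: ypos xpos)
      ultimately show ?thesis unfolding val using y(2) by simp
    qed
    then have "m \<in> open_halfspaces_inter (insert c K)"
      unfolding open_halfspaces_inter_def by blast
    with m show ?case by blast
  qed
  from this[of I] assms show False by blast
qed

lemma (in subfield_of_reals) rational_translate_dense:
  fixes y :: "real ^ 'n"
  assumes "open U" "U \<noteq> {}"
  obtains w N where "w \<in> int_vecs" "N > (0::nat)" "y + (1 / real N) *\<^sub>R w \<in> U"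
proof -
  obtain x where x: "x \<in> U" using assms by auto
  then obtain e where e: "e > 0" "ball x e \<subseteq> U" using assms open_contains_ball by blast
  obtain N where N: "N > 0" "real CARD('n) / real N < e"
  proof -
    obtain N where "real N > real CARD('n) / e" using reals_Archimedean2 by blast
    moreover have "real CARD('n) / e > 0" using e by simp
    ultimately have "real N > 0" by linarith
    then show ?thesis using \<open>real N > real CARD('n) / e\<close> e(1)
      by (intro that[of N]) (auto simp: field_simps)
  qed
  define w :: "real ^ 'n" where "w = (\<chi> i. of_int \<lfloor>real N * (x $ i - y $ i)\<rfloor>)"
  have "\<bar>(x - (y + (1 / real N) *\<^sub>R w)) $ i\<bar> \<le> 1 / real N" for i
  proof -
    have "(x - (y + (1 / real N) *\<^sub>R w)) $ i
        = (real N * (x $ i - y $ i) - of_int \<lfloor>real N * (x $ i - y $ i)\<rfloor>) / real N"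
      using N by (simp add: w_def field_simps)
    moreover have "0 \<le> real N * (x $ i - y $ i) - of_int \<lfloor>real N * (x $ i - y $ i)\<rfloor>"
      "real N * (x $ i - y $ i) - of_int \<lfloor>real N * (x $ i - y $ i)\<rfloor> \<le> 1"
      by linarith+
    ultimately show ?thesis using N by (simp add: divide_right_mono)
  qed
  then have "norm (x - (y + (1 / real N) *\<^sub>R w)) \<le> (\<Sum>i\<in>(UNIV::'n set). 1 / real N)"
    by (intro order.trans[OF norm_le_l1_cart] sum_mono) auto
  also have "\<dots> < e" using N by simp
  finally have "y + (1 / real N) *\<^sub>R w \<in> ball x e" by (simp add: dist_norm)
  moreover have "w \<in> int_vecs" by (auto simp: w_def rational_points_def)
  ultimately show ?thesis using that N e by blast
qed

lemma (in subfield_of_reals) F_vecs_dense: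
  fixes U :: "(real ^ 'n) set"
  assumes "open U" "U \<noteq> {}"
  obtains x where "x \<in> F_vecs" "x \<in> U"
proof -
  obtain w :: "real ^ 'n" and N where *: "w \<in> int_vecs" "0 + (1 / real N) *\<^sub>R w \<in> U"
    using rational_translate_dense[OF assms] by metis
  have "0 + (1 / real N) *\<^sub>R w \<in> F_vecs"
    using *(1) by (intro F_vecs_shift F_intros int_vecs_subset int_vecs_intros) auto
  then show ?thesis using that * by blast
qed

context subfield_of_reals
begin

lemma rational_chain:
  fixes U :: "(real ^ 'n) set"
  assumes U: "open U" "convex U"
    and step: "\<And>x r w. x \<in> F_vecs \<Longrightarrow> r \<in> F \<Longrightarrow> w \<in> int_vecs \<Longrightarrow> x \<in> U \<Longrightarrow> x + r *\<^sub>R w \<in> U \<Longrightarrow>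
        x + (2 * r) *\<^sub>R w \<in> U \<Longrightarrow> P x \<Longrightarrow> P (x + r *\<^sub>R w)"
    and x: "x \<in> F_vecs" "x \<in> U" "P x" and y: "y \<in> F_vecs" "y \<in> U"
  shows "P y"
proof (rule connected_induction[where S = U and P = "\<lambda>z. z \<in> F_vecs" and Q = P and a = x and b = y])
  show "connected U" using U(2) by (rule convex_connected)
  show "\<exists>z. z \<in> T \<and> z \<in> F_vecs" if "openin (top_of_set U) T" "a \<in> T" for T a
  proof -
    have "open T" "T \<noteq> {}" using that U(1) by (auto simp: openin_open_eq)
    then show ?thesis by (meson F_vecs_dense)
  qed
  show "\<exists>T. openin (top_of_set U) T \<and> p \<in> T \<and>
      (\<forall>x\<in>T. \<forall>y\<in>T. x \<in> F_vecs \<and> y \<in> F_vecs \<and> P x \<longrightarrow> P y)" if p: "p \<in> U" for p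
  proof -
    obtain e where e: "e > 0" "ball p e \<subseteq> U" using U(1) p open_contains_ball by blast
    have "P y" if xy: "x \<in> ball p (e / 8)" "y \<in> ball p (e / 8)" "x \<in> F_vecs" "y \<in> F_vecs" "P x" for x y
    proof -
      have xp: "norm (x - p) < e / 8" and yx: "norm (y - x) < e / 4"
        using xy norm_triangle_ineq4[of "p - x" "p - y"]
        by (auto simp: dist_norm norm_minus_commute)
      have inU: "z \<in> U" if "\<And>i. \<bar>(z - x) $ i\<bar> \<le> \<bar>(2 *\<^sub>R (y - x)) $ i\<bar>" for z
      proof -
        have "norm (z - x) \<le> norm (2 *\<^sub>R (y - x))"
          using that by (intro norm_le_componentwise_cart) auto
        then have "norm (z - p) < e"
          using xp yx e(1) norm_triangle_ineq[of "z - x" "x - p"] by simp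
        then show "z \<in> U" using e by (auto simp: dist_norm norm_minus_commute subset_iff)
      qed
      define Z where "Z A = (\<chi> i. if i \<in> A then y $ i else x $ i)" for A
      have "P (Z A)" for A
      proof (induction A rule: infinite_finite_induct)
        case (insert i A)
        let ?r = "y $ i - x $ i"
        have Z: "Z (insert i A) = Z A + ?r *\<^sub>R axis i 1"
          using insert by (auto simp: Z_def vec_eq_iff axis_def)
        show ?case unfolding Z
        proof (rule step)
          show "Z A \<in> F_vecs" "?r \<in> F" "axis i 1 \<in> (int_vecs :: (real ^ 'n) set)"
            using xy by (auto simp: Z_def rational_points_def axis_def intro: F_intros)
          show "Z A \<in> U" by (rule inU) (auto simp: Z_def)
          show "Z A + ?r *\<^sub>R axis i 1 \<in> U"
            by (rule inU) (use insert in \<open>auto simp: Z_def axis_def\<close>)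
          show "Z A + (2 * ?r) *\<^sub>R axis i 1 \<in> U"
            by (rule inU) (use insert in \<open>auto simp: Z_def axis_def\<close>)
          show "P (Z A)" by fact
        qed
      qed (use xy in \<open>auto simp: Z_def\<close>)
      from this[of UNIV] show "P y" by (simp add: Z_def)
    qed
    moreover have "openin (top_of_set U) (ball p (e / 8))"
      using e by (auto simp: openin_open_eq[OF U(1)])
    ultimately show ?thesis using e(1) by (intro exI[of _ "ball p (e / 8)"]) auto
  qed
qed (use x y in auto)

text \<open>Convexity is only available between points that differ by an element of \<open>F \<cdot> \<int>\<^sup>n\<close>.\<close>

definition F_convex_on :: "(real ^ 'n) set \<Rightarrow> (real ^ 'n \<Rightarrow> real) \<Rightarrow> bool" where
  "F_convex_on D q \<longleftrightarrow> (\<forall>x\<in>F_vecs. \<forall>v\<in>int_vecs. \<forall>t\<in>F. \<forall>s\<in>F. 0 \<le> s \<longrightarrow> s \<le> 1 \<longrightarrow>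
     x \<in> D \<longrightarrow> x + t *\<^sub>R v \<in> D \<longrightarrow> q (x + (s * t) *\<^sub>R v) \<le> (1 - s) * q x + s * q (x + t *\<^sub>R v))"

lemma F_convex_onD:
  assumes "F_convex_on D q" "x \<in> F_vecs" "v \<in> int_vecs" "t \<in> F" "s \<in> F" "0 \<le> s" "s \<le> 1"
    "x \<in> D" "x + t *\<^sub>R v \<in> D"
  shows "q (x + (s * t) *\<^sub>R v) \<le> (1 - s) * q x + s * q (x + t *\<^sub>R v)"
  using assms unfolding F_convex_on_def by blast

lemma F_convex_on_subset: "F_convex_on D q \<Longrightarrow> E \<subseteq> D \<Longrightarrow> F_convex_on E q"
  unfolding F_convex_on_def by blast

text \<open>An integer-valued convex function that exceeded \<open>c\<close> in the middle of a segment would jump by at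
  least \<open>1\<close> over arbitrarily short steps, so convexity would force an arbitrarily large value at the far end.\<close>

lemma integer_convex_step:
  assumes q: "F_convex_on U q" "\<And>z. z \<in> F_vecs \<Longrightarrow> z \<in> U \<Longrightarrow> q z \<in> \<int>" and U: "convex U"
    and x: "x \<in> F_vecs" "w \<in> int_vecs" "r \<in> F" "x \<in> U" "x + (2 * r) *\<^sub>R w \<in> U"
    and c: "c \<in> \<int>" "q x \<le> c"
  shows "q (x + r *\<^sub>R w) \<le> c"
proof (rule ccontr)
  assume neg: "\<not> ?thesis"
  let ?B = "q (x + (2 * r) *\<^sub>R w)"
  obtain N :: nat where N: "real N > \<bar>?B - c\<bar>" using reals_Archimedean2 by blast
  then have N0: "N > 0" by (cases N) auto
  define z where "z k = x + (real k / real N * r) *\<^sub>R w" for k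
  have zF: "z k \<in> F_vecs" for k
    unfolding z_def using x by (intro F_vecs_shift F_intros) auto
  have zU: "z k \<in> U" if "k \<le> N" for k
  proof -
    have "(1 - real k / (2 * real N)) *\<^sub>R x + (real k / (2 * real N)) *\<^sub>R (x + (2 * r) *\<^sub>R w) \<in> U"
      using that N0 by (intro convexD[OF U x(4,5)]) (auto simp: field_simps)
    moreover have "(1 - real k / (2 * real N)) *\<^sub>R x + (real k / (2 * real N)) *\<^sub>R (x + (2 * r) *\<^sub>R w) = z k"
      by (simp add: z_def algebra_simps)
    ultimately show ?thesis by simp
  qed
  have "\<exists>k<N. q (z k) \<le> c \<and> \<not> q (z (Suc k)) \<le> c"
  proof (rule ccontr)
    assume "\<not> ?thesis"
    then have "q (z k) \<le> c" if "k \<le> N" for k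
      using that by (induction k) (use c in \<open>auto simp: z_def\<close>)
    from this[of N] neg N0 show False by (simp add: z_def)
  qed
  then obtain k where k: "k < N" "q (z k) \<le> c" "q (z (Suc k)) > c" by auto
  have "q (z (Suc k)) \<in> \<int>" using k by (intro q zF zU) auto
  with k(3) c(1) have up: "q (z (Suc k)) \<ge> c + 1"
    by (auto elim!: Ints_cases)
  define s where "s = 1 / (2 * real N - real k)"
  have M: "2 * real N - real k > real N" using k by simp
  have s: "0 < s" "s \<le> 1" "s \<in> F" using M N0 by (auto simp: s_def intro!: F_intros)
  let ?t = "(2 - real k / real N) * r"
  have e1: "z k + ?t *\<^sub>R w = x + (2 * r) *\<^sub>R w"
    by (simp add: z_def algebra_simps)
  have "s * (2 - real k / real N) = 1 / real N"
    using M N0 by (simp add: s_def field_simps)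
  then have "real k / real N * r + s * ?t = real (Suc k) / real N * r"
    by (metis (no_types, lifting) add.commute add_divide_distrib distrib_right mult.assoc of_nat_Suc)
  then have e2: "z k + (s * ?t) *\<^sub>R w = z (Suc k)"
    unfolding z_def by (metis (no_types, lifting) add.assoc scaleR_add_left)
  have "q (z (Suc k)) \<le> (1 - s) * q (z k) + s * ?B"
    unfolding e2[symmetric] e1[symmetric]
    by (rule F_convex_onD[OF q(1)]) (use x s zF zU[of k] k e1 in \<open>auto intro!: F_intros\<close>)
  also have "\<dots> \<le> (1 - s) * c + s * ?B"
    using k s by (intro add_right_mono mult_left_mono) auto
  finally have "1 \<le> s * (?B - c)" using up by (simp add: algebra_simps)
  then have "2 * real N - real k \<le> ?B - c" using M by (simp add: s_def field_simps)
  with M N show False by linarith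
qed

text \<open>Dividing \<open>a\<close> by the gcd of its entries gives a covector \<open>p\<close> with \<open>p \<bullet> u = 1\<close> for an integral \<open>u\<close>;
  projecting along \<open>u\<close> retracts the space onto the hyperplane and preserves integrality.
  It turns a problem on a facet into a problem on the whole space with fewer inequalities.\<close>

lemma project_out:
  fixes I :: "((real ^ 'n) \<times> real) set"
  assumes I: "integral_system I" "(a, b) \<in> I" and z: "a \<bullet> z + b = 0"
  obtains A d J where "linear A" "\<And>v. v \<in> int_vecs \<Longrightarrow> A v \<in> int_vecs"
    "\<And>x. x \<in> F_vecs \<Longrightarrow> A x + d \<in> F_vecs" "integral_system J" "card J < card I"
    "\<And>x. A x + d \<in> halfspaces_inter I \<longleftrightarrow> x \<in> halfspaces_inter J"
    "\<And>x. a \<bullet> x + b = 0 \<Longrightarrow> A x + d = x"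
proof (cases "a = 0")
  case True
  then have b: "b = 0" using z by simp
  show ?thesis
  proof (rule that[of id 0 "I - {(a, b)}"])
    show "integral_system (I - {(a, b)})" using I by (auto simp: integral_system_def)
    show "card (I - {(a, b)}) < card I"
      using I by (meson card_Diff1_less integral_system_def)
    show "id x + 0 \<in> halfspaces_inter I \<longleftrightarrow> x \<in> halfspaces_inter (I - {(a, b)})" for x
      using True b by (auto simp: halfspaces_inter_def)
  qed (auto simp: linear_id)
next
  case False
  have a: "a \<in> int_vecs" and b: "b \<in> F" using I by (auto simp: integral_system_def)
  obtain j where "a \<bullet> a = real_of_int j" using int_vecs_inner[OF a a] by (rule Ints_cases)
  moreover have "a \<bullet> a > 0" using False by simp
  ultimately have "nat j > 0 \<and> a \<bullet> a = real (nat j)" by simp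
  with a have "\<exists>k. k > 0 \<and> (\<exists>u\<in>int_vecs. a \<bullet> u = real k)" by blast
  then obtain g where "g > 0 \<and> (\<exists>u\<in>int_vecs. a \<bullet> u = real g)"
    and least': "\<And>k. k < g \<Longrightarrow> \<not> (k > 0 \<and> (\<exists>u\<in>int_vecs. a \<bullet> u = real k))"
    unfolding exists_least_iff[of "\<lambda>k. k > 0 \<and> (\<exists>u\<in>int_vecs. a \<bullet> u = real k)"] by blast
  then obtain u where g: "g > 0" and u: "u \<in> int_vecs" "a \<bullet> u = real g" by blast
  have least: "a \<bullet> u' \<noteq> real k" if "0 < k" "k < g" "u' \<in> int_vecs" for k u'
    using least' that by blast
  have div: "a $ i / real g \<in> \<int>" for i
  proof -
    define m where "m = \<lfloor>a $ i / real g\<rfloor>"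
    let ?r = "a $ i - real_of_int m * real g"
    have r: "?r = a \<bullet> (axis i 1 - of_int m *\<^sub>R u)"
      by (simp add: inner_diff_right u inner_axis)
    have w: "axis i 1 - of_int m *\<^sub>R u \<in> int_vecs"
      using u by (intro int_vecs_intros) auto
    have "0 \<le> ?r" "?r < real g"
      using g floor_divide_lower[of "real g" "a $ i"] floor_divide_upper[of "real g" "a $ i"]
      by (auto simp: m_def algebra_simps)
    moreover obtain j where "?r = real_of_int j"
      using int_vecs_inner[OF a w] r by (metis Ints_cases)
    ultimately have "?r = real (nat j)" "nat j < g" by auto
    with least[of "nat j", OF _ _ w] r have "nat j = 0" by fastforce
    with \<open>?r = real (nat j)\<close> have "a $ i / real g = of_int m" using g by (simp add: field_simps)
    then show ?thesis by simp
  qed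
  define p where "p = (1 / real g) *\<^sub>R a"
  define c where "c = b / real g"
  have p: "p \<in> int_vecs" using div by (auto simp: p_def rational_points_def)
  have c: "c \<in> F" using b by (auto simp: c_def intro: F_intros)
  have ap: "a = real g *\<^sub>R p" and bc: "b = real g * c" using g by (auto simp: p_def c_def)
  have pu: "p \<bullet> u = 1" using u g by (simp add: p_def)
  define red where "red = (\<lambda>(a' :: real ^ 'n, b'). (a' - (a' \<bullet> u) *\<^sub>R p, b' - (a' \<bullet> u) * c))"
  show ?thesis
  proof (rule that[of "\<lambda>x. x - (p \<bullet> x) *\<^sub>R u" "- c *\<^sub>R u" "red ` (I - {(a, b)})"])
    show "linear (\<lambda>x. x - (p \<bullet> x) *\<^sub>R u)"
      by (intro linearI) (auto simp: inner_add_right algebra_simps)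
    show "v - (p \<bullet> v) *\<^sub>R u \<in> int_vecs" if "v \<in> int_vecs" for v
      using that u p by (auto intro!: int_vecs_intros int_vecs_inner)
    show "x - (p \<bullet> x) *\<^sub>R u + - c *\<^sub>R u \<in> F_vecs" if "x \<in> F_vecs" for x
      using that u p c by (simp add: F_vecs_diff F_vecs_scaleR F_inner int_vecs_subset)
    show "integral_system (red ` (I - {(a, b)}))"
    proof -
      have "red y \<in> int_vecs \<times> F" if "y \<in> I" for y
        using that I u p c unfolding red_def integral_system_def
        by (auto simp: int_vecs_diff int_vecs_scaleR int_vecs_inner F_diff F_mult F_inner int_vecs_subset)
      then have "red ` (I - {(a, b)}) \<subseteq> int_vecs \<times> F" by blast
      then show ?thesis using I by (simp add: integral_system_def)
    qed
    show "card (red ` (I - {(a, b)})) < card I"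
      using I by (meson card_Diff1_less card_image_le finite_Diff integral_system_def le_less_trans)
    have val: "a' \<bullet> (x - (p \<bullet> x) *\<^sub>R u + - c *\<^sub>R u) + b'
        = (a' - (a' \<bullet> u) *\<^sub>R p) \<bullet> x + (b' - (a' \<bullet> u) * c)" for a' b' x
      by (simp add: inner_diff_left inner_diff_right algebra_simps)
    have self: "a \<bullet> (x - (p \<bullet> x) *\<^sub>R u + - c *\<^sub>R u) + b = 0" for x
      unfolding val by (simp add: ap bc inner_diff_left pu u(2)[unfolded ap])
    show "x - (p \<bullet> x) *\<^sub>R u + - c *\<^sub>R u \<in> halfspaces_inter I
        \<longleftrightarrow> x \<in> halfspaces_inter (red ` (I - {(a, b)}))" for x
    proof -
      have "x - (p \<bullet> x) *\<^sub>R u + - c *\<^sub>R u \<in> halfspaces_inter I \<longleftrightarrow>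
        (\<forall>(a', b')\<in>I - {(a, b)}. a' \<bullet> (x - (p \<bullet> x) *\<^sub>R u + - c *\<^sub>R u) + b' \<ge> 0)"
        using self[of x] unfolding halfspaces_inter_def by fastforce
      then show ?thesis unfolding val by (simp add: halfspaces_inter_def red_def case_prod_beta)
    qed
    show "x - (p \<bullet> x) *\<^sub>R u + - c *\<^sub>R u = x" if "a \<bullet> x + b = 0" for x
    proof -
      have "real g * (p \<bullet> x + c) = 0" using that by (simp add: ap bc algebra_simps)
      then have "p \<bullet> x = - c" using g by simp
      then show ?thesis by simp
    qed
  qed
qed

lemma integer_convex_bounded_below:
  fixes J :: "((real ^ 'n) \<times> real) set"
  assumes "integral_system J" "open U" "convex U" "F_convex_on (halfspaces_inter J \<inter> U) q"
    "\<And>x. x \<in> F_vecs \<Longrightarrow> x \<in> halfspaces_inter J \<inter> U \<Longrightarrow> q x \<in> \<int>"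
  shows "\<exists>c. \<forall>x \<in> F_vecs \<inter> (halfspaces_inter J \<inter> U). c \<le> q x"
  using assms
proof (induction "card J" arbitrary: J U q rule: less_induct)
  case less
  note fin = less.prems(1)[unfolded integral_system_def, THEN conjunct1]
  let ?V = "open_halfspaces_inter J \<inter> U"
  have VP: "?V \<subseteq> halfspaces_inter J \<inter> U" using open_halfspaces_inter_subset by blast
  show ?case
  proof (cases "?V = {}")
    case False
    have V: "open ?V" "convex ?V"
      using less.prems fin by (auto intro!: open_Int convex_Int open_halfspaces_inter_open open_halfspaces_inter_convex)
    obtain x0 where x0: "x0 \<in> F_vecs" "x0 \<in> ?V" using F_vecs_dense[OF V(1) False] by blast
    note cV = F_convex_on_subset[OF less.prems(4) VP]
    have le: "q y \<le> q x" if "x \<in> F_vecs" "x \<in> ?V" "y \<in> F_vecs" "y \<in> ?V" for x y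
      by (rule rational_chain[of ?V "\<lambda>z. q z \<le> q x" x])
        (use V that cV less.prems(5) VP in \<open>auto intro!: integer_convex_step[of ?V q]\<close>)
    then have const: "q y = q x0" if "y \<in> F_vecs" "y \<in> ?V" for y
      using that x0 by (meson order.antisym)
    have "q x0 \<le> q z" if z: "z \<in> F_vecs" "z \<in> halfspaces_inter J \<inter> U" for z
    proof -
      obtain w N where w: "w \<in> int_vecs" "N > (0::nat)" "z + (1 / real N) *\<^sub>R w \<in> ?V"
        using rational_translate_dense[OF V(1) False] by metis
      let ?t = "1 / real N"
      have tF: "?t \<in> F" by (intro F_intros) auto
      have "(1 - 1 / 2) *\<^sub>R z + (1 / 2) *\<^sub>R (z + ?t *\<^sub>R w) \<in> open_halfspaces_inter J"
        using z w by (intro halfspaces_inter_segment) auto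
      moreover have "(1 - 1 / 2) *\<^sub>R z + (1 / 2) *\<^sub>R (z + ?t *\<^sub>R w) \<in> U"
        using z w less.prems(3) by (intro convexD) auto
      moreover have "(1 - 1 / 2) *\<^sub>R z + (1 / 2) *\<^sub>R (z + ?t *\<^sub>R w) = z + (1 / 2 * ?t) *\<^sub>R w"
        by (simp add: vec_eq_iff field_simps)
      ultimately have m: "z + (1 / 2 * ?t) *\<^sub>R w \<in> ?V" by simp
      have mF: "z + (1 / 2 * ?t) *\<^sub>R w \<in> F_vecs" "z + ?t *\<^sub>R w \<in> F_vecs"
        using z w tF by (auto intro!: F_vecs_shift F_intros)
      have "q (z + (1 / 2 * ?t) *\<^sub>R w) \<le> (1 - 1 / 2) * q z + 1 / 2 * q (z + ?t *\<^sub>R w)"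
        by (rule F_convex_onD[OF less.prems(4)]) (use z w tF VP in \<open>auto intro!: F_intros\<close>)
      then show ?thesis using const[OF mF(1) m] const[OF mF(2) w(3)] by simp
    qed
    then show ?thesis by blast
  next
    case True
    show ?thesis
    proof (cases "halfspaces_inter J \<inter> U = {}")
      case False
      obtain a b where ab: "(a, b) \<in> J" and eq: "\<And>x. x \<in> halfspaces_inter J \<inter> U \<Longrightarrow> a \<bullet> x + b = 0"
        using implicit_equality[OF fin less.prems(3) True False] by blast
      obtain z where "a \<bullet> z + b = 0" using eq False by blast
      from project_out[OF less.prems(1) ab this] obtain A d J' where
        A: "linear A" "\<And>v. v \<in> int_vecs \<Longrightarrow> A v \<in> int_vecs"
        "\<And>x. x \<in> F_vecs \<Longrightarrow> A x + d \<in> F_vecs" "integral_system J'" "card J' < card J"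
        "\<And>x. A x + d \<in> halfspaces_inter J \<longleftrightarrow> x \<in> halfspaces_inter J'"
        "\<And>x. a \<bullet> x + b = 0 \<Longrightarrow> A x + d = x" by blast
      let ?h = "\<lambda>x. A x + d"
      have shift: "?h (x + t *\<^sub>R v) = ?h x + t *\<^sub>R A v" for x t v
        using A(1) by (simp add: linear_add linear_scale)
      have "\<exists>c. \<forall>x\<in>F_vecs \<inter> (halfspaces_inter J' \<inter> ?h -` U). c \<le> (q \<circ> ?h) x"
      proof (rule less.hyps[OF A(5,4)])
        show "open (?h -` U)"
          using less.prems(2) A(1)
          by (intro open_vimage continuous_on_add continuous_on_const linear_continuous_on)
             (simp_all add: linear_conv_bounded_linear)
        show "convex (?h -` U)"
        proof (rule convexI)
          fix x y and s t :: real assume xy: "x \<in> ?h -` U" "y \<in> ?h -` U" "0 \<le> s" "0 \<le> t" "s + t = 1"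
          have "A (s *\<^sub>R x + t *\<^sub>R y) + (s + t) *\<^sub>R d = s *\<^sub>R ?h x + t *\<^sub>R ?h y"
            using A(1) by (simp add: linear_add linear_scale algebra_simps)
          then have "?h (s *\<^sub>R x + t *\<^sub>R y) = s *\<^sub>R ?h x + t *\<^sub>R ?h y"
            using xy(5) by simp
          then show "s *\<^sub>R x + t *\<^sub>R y \<in> ?h -` U"
            using xy convexD[OF less.prems(3), of "?h x" "?h y" s t] by simp
        qed
        show "F_convex_on (halfspaces_inter J' \<inter> ?h -` U) (q \<circ> ?h)"
          unfolding F_convex_on_def
        proof (intro ballI impI)
          fix x v t s assume *: "x \<in> F_vecs" "v \<in> int_vecs" "t \<in> F" "s \<in> F" "0 \<le> s" "s \<le> 1"
            "x \<in> halfspaces_inter J' \<inter> ?h -` U" "x + t *\<^sub>R v \<in> halfspaces_inter J' \<inter> ?h -` U"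
          have "?h x \<in> halfspaces_inter J \<inter> U" "?h x + t *\<^sub>R A v \<in> halfspaces_inter J \<inter> U"
            using *(7,8) A(6)[of x] A(6)[of "x + t *\<^sub>R v"] unfolding shift vimage_def by (auto simp: shift)
          then show "(q \<circ> ?h) (x + (s * t) *\<^sub>R v) \<le> (1 - s) * (q \<circ> ?h) x + s * (q \<circ> ?h) (x + t *\<^sub>R v)"
            unfolding o_def shift using * A(2,3) by (intro F_convex_onD[OF less.prems(4)]) auto
        qed
        show "(q \<circ> ?h) x \<in> \<int>" if "x \<in> F_vecs" "x \<in> halfspaces_inter J' \<inter> ?h -` U" for x
          using that A(3,6) less.prems(5)[of "?h x"] by auto
      qed
      then obtain c where c: "\<And>x. x \<in> F_vecs \<Longrightarrow> x \<in> halfspaces_inter J' \<Longrightarrow> ?h x \<in> U \<Longrightarrow> c \<le> q (?h x)"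
        by auto
      have "c \<le> q x" if "x \<in> F_vecs" "x \<in> halfspaces_inter J \<inter> U" for x
        using c[of x] A(6)[of x] A(7)[OF eq[OF that(2)]] that by auto
      then show ?thesis by blast
    qed auto
  qed
qed

end

definition max_affine :: "((real ^ 'n) \<times> real) set \<Rightarrow> real ^ 'n \<Rightarrow> real" where
  "max_affine K x = Max ((\<lambda>(a, b). a \<bullet> x + b) ` K)"

lemma max_affine_ge: "finite K \<Longrightarrow> (a, b) \<in> K \<Longrightarrow> a \<bullet> x + b \<le> max_affine K x"
  unfolding max_affine_def by (rule Max_ge) auto

lemma max_affine_attained:
  assumes "finite K" "K \<noteq> {}"
  obtains a b where "(a, b) \<in> K" "max_affine K x = a \<bullet> x + b"
proof -
  have "max_affine K x \<in> (\<lambda>(a, b). a \<bullet> x + b) ` K"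
    unfolding max_affine_def using assms by (intro Max_in) auto
  then show ?thesis using that by auto
qed

lemma max_affine_eqI:
  assumes "finite K" "\<And>a b. (a, b) \<in> K \<Longrightarrow> a \<bullet> x + b \<le> m" "(a0, b0) \<in> K" "m \<le> a0 \<bullet> x + b0"
  shows "max_affine K x = m"
proof -
  obtain a b where "(a, b) \<in> K" "max_affine K x = a \<bullet> x + b"
    using max_affine_attained[of K] assms by blast
  with assms max_affine_ge[OF assms(1,3), of x] show ?thesis by fastforce
qed

lemma eventually_affine_less:
  fixes p q p' q' :: real
  assumes "p < p'"
  shows "\<forall>\<^sub>F t in at_right 0. p + q * t < p' + q' * t"
proof -
  have "((\<lambda>t. p' + q' * t - (p + q * t)) \<longlongrightarrow> p' + q' * 0 - (p + q * 0)) (at_right 0)"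
    by (intro tendsto_intros)
  then have "\<forall>\<^sub>F t in at_right 0. 0 < p' + q' * t - (p + q * t)"
    using assms by (intro order_tendstoD(1)) auto
  then show ?thesis by eventually_elim simp
qed

lemma halfspaces_inter_feasible:
  assumes "finite I" "z \<in> halfspaces_inter I"
    and "\<And>a b. (a, b) \<in> I \<Longrightarrow> a \<bullet> z + b > 0 \<or> a \<bullet> v \<ge> 0"
  shows "\<forall>\<^sub>F t in at_right 0. z + t *\<^sub>R v \<in> halfspaces_inter I"
proof -
  have "\<forall>\<^sub>F t in at_right 0. \<forall>y\<in>I. fst y \<bullet> (z + t *\<^sub>R v) + snd y \<ge> 0"
  proof (intro eventually_ball_finite assms(1) ballI)
    fix y assume y: "y \<in> I"
    have 0: "fst y \<bullet> z + snd y \<ge> 0" using assms(2) y by (auto simp: halfspaces_inter_def)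
    show "\<forall>\<^sub>F t in at_right 0. fst y \<bullet> (z + t *\<^sub>R v) + snd y \<ge> 0"
    proof (cases "fst y \<bullet> v \<ge> 0")
      case True
      have "\<forall>\<^sub>F t in at_right (0 :: real). t > 0" by (rule eventually_at_right_less)
      then show ?thesis
      proof eventually_elim
        case (elim t)
        then have "t * (fst y \<bullet> v) \<ge> 0" using True by simp
        with 0 show ?case by (simp add: inner_add_right)
      qed
    next
      case False
      then have "0 < fst y \<bullet> z + snd y" using assms(3)[of "fst y" "snd y"] y by auto
      then have "\<forall>\<^sub>F t in at_right 0. 0 + 0 * t < fst y \<bullet> z + snd y + (fst y \<bullet> v) * t"
        by (rule eventually_affine_less)
      then show ?thesis by eventually_elim (simp add: inner_add_right mult.commute)
    qed
  qed
  then show ?thesis by eventually_elim (auto simp: halfspaces_inter_def)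
qed

lemma open_feasible:
  fixes x v :: "'a :: real_normed_vector"
  assumes "open V" "x \<in> V"
  shows "\<forall>\<^sub>F t in at_right (0 :: real). x + t *\<^sub>R v \<in> V"
proof -
  have "((\<lambda>t. x + t *\<^sub>R v) \<longlongrightarrow> x + 0 *\<^sub>R v) (at_right (0 :: real))"
    by (intro tendsto_intros)
  then show ?thesis using assms by (intro topological_tendstoD) auto
qed

lemma finite_uniform_lower_bound:
  fixes q :: "'b \<Rightarrow> real"
  assumes "finite A" "\<And>a. a \<in> A \<Longrightarrow> \<exists>c. \<forall>z. R a z \<longrightarrow> c \<le> q z"
  shows "\<exists>c. \<forall>a\<in>A. \<forall>z. R a z \<longrightarrow> c \<le> q z"
  using assms
proof (induction A rule: finite_induct)
  case (insert a A)
  obtain c where "\<forall>a\<in>A. \<forall>z. R a z \<longrightarrow> c \<le> q z" using insert.IH insert.prems by blast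
  moreover obtain c' where "\<forall>z. R a z \<longrightarrow> c' \<le> q z" using insert.prems[of a] by blast
  ultimately show ?case by (intro exI[of _ "min c c'"]) (auto simp: min_le_iff_disj)
qed auto

context subfield_of_reals
begin

definition line_polyhedral :: "(real ^ 'n) set \<Rightarrow> (real ^ 'n \<Rightarrow> real) \<Rightarrow> bool" where
  "line_polyhedral S f \<longleftrightarrow> (\<forall>x\<in>F_vecs. \<forall>v\<in>int_vecs. \<exists>\<Gamma>. finite \<Gamma> \<and> \<Gamma> \<noteq> {} \<and> \<Gamma> \<subseteq> \<int> \<times> F \<and>
     (\<forall>t\<in>F. x + t *\<^sub>R v \<in> S \<longrightarrow> f (x + t *\<^sub>R v) = Max ((\<lambda>(c, d). c * t + d) ` \<Gamma>)))"

lemma line_polyhedralE: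
  assumes "line_polyhedral S f" "x \<in> F_vecs" "v \<in> int_vecs"
  obtains \<Gamma> where "finite \<Gamma>" "\<Gamma> \<noteq> {}" "\<Gamma> \<subseteq> \<int> \<times> F"
    "\<And>t c d. t \<in> F \<Longrightarrow> x + t *\<^sub>R v \<in> S \<Longrightarrow> (c, d) \<in> \<Gamma> \<Longrightarrow> c * t + d \<le> f (x + t *\<^sub>R v)"
    "\<And>t. t \<in> F \<Longrightarrow> x + t *\<^sub>R v \<in> S \<Longrightarrow> \<exists>(c, d)\<in>\<Gamma>. f (x + t *\<^sub>R v) = c * t + d"
proof -
  obtain \<Gamma> where \<Gamma>: "finite \<Gamma>" "\<Gamma> \<noteq> {}" "\<Gamma> \<subseteq> \<int> \<times> F"
    "\<And>t. t \<in> F \<Longrightarrow> x + t *\<^sub>R v \<in> S \<Longrightarrow> f (x + t *\<^sub>R v) = Max ((\<lambda>(c, d). c * t + d) ` \<Gamma>)"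
    using assms unfolding line_polyhedral_def by meson
  show ?thesis
  proof (rule that[OF \<Gamma>(1-3)])
    show "c * t + d \<le> f (x + t *\<^sub>R v)" if "t \<in> F" "x + t *\<^sub>R v \<in> S" "(c, d) \<in> \<Gamma>" for t c d
      unfolding \<Gamma>(4)[OF that(1,2)] using that \<Gamma> by (intro Max_ge) auto
    show "\<exists>(c, d)\<in>\<Gamma>. f (x + t *\<^sub>R v) = c * t + d" if "t \<in> F" "x + t *\<^sub>R v \<in> S" for t
    proof -
      have "f (x + t *\<^sub>R v) \<in> (\<lambda>(c, d). c * t + d) ` \<Gamma>"
        unfolding \<Gamma>(4)[OF that(1,2)] using that \<Gamma> by (intro Max_in) auto
      then show ?thesis by auto
    qed
  qed
qed

lemma line_polyhedral_value_in_F: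
  assumes "line_polyhedral S f" "x \<in> F_vecs" "x \<in> S"
  shows "f x \<in> F"
proof -
  obtain \<Gamma> where \<Gamma>: "\<Gamma> \<subseteq> \<int> \<times> F"
    "\<And>t. t \<in> F \<Longrightarrow> x + t *\<^sub>R 0 \<in> S \<Longrightarrow> \<exists>(c, d)\<in>\<Gamma>. f (x + t *\<^sub>R 0) = c * t + d"
    using line_polyhedralE[OF assms(1,2) int_vecs_zero] by metis
  from \<Gamma>(2)[of 0] \<Gamma>(1) assms(3) show ?thesis by auto
qed

lemma line_polyhedral_F_convex_on:
  assumes "line_polyhedral S f" "convex S"
  shows "F_convex_on S f"
  unfolding F_convex_on_def
proof (intro ballI impI)
  fix x v t s assume *: "x \<in> F_vecs" "v \<in> int_vecs" "t \<in> F" "s \<in> F" "0 \<le> s" "s \<le> 1"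
    "x \<in> S" "x + t *\<^sub>R v \<in> S"
  obtain \<Gamma> where \<Gamma>:
    "\<And>t c d. t \<in> F \<Longrightarrow> x + t *\<^sub>R v \<in> S \<Longrightarrow> (c, d) \<in> \<Gamma> \<Longrightarrow> c * t + d \<le> f (x + t *\<^sub>R v)"
    "\<And>t. t \<in> F \<Longrightarrow> x + t *\<^sub>R v \<in> S \<Longrightarrow> \<exists>(c, d)\<in>\<Gamma>. f (x + t *\<^sub>R v) = c * t + d"
    using line_polyhedralE[OF assms(1) *(1,2)] by metis
  have "(1 - s) *\<^sub>R x + s *\<^sub>R (x + t *\<^sub>R v) \<in> S" using * assms(2) by (intro convexD) auto
  then have "x + (s * t) *\<^sub>R v \<in> S" by (simp add: algebra_simps)
  then obtain c d where cd: "(c, d) \<in> \<Gamma>" "f (x + (s * t) *\<^sub>R v) = c * (s * t) + d"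
    using \<Gamma>(2)[of "s * t"] * by (auto intro: F_intros)
  have "c * t + d \<le> f (x + t *\<^sub>R v)" "c * 0 + d \<le> f (x + 0 *\<^sub>R v)"
    by (rule \<Gamma>(1)[OF _ _ cd(1)]; use * in simp)+
  then have "s * (c * t + d) \<le> s * f (x + t *\<^sub>R v)" "(1 - s) * d \<le> (1 - s) * f x"
    using * by (auto intro: mult_left_mono)
  then show "f (x + (s * t) *\<^sub>R v) \<le> (1 - s) * f x + s * f (x + t *\<^sub>R v)"
    unfolding cd(2) by (simp add: algebra_simps)
qed

lemma eventually_F_witness:
  assumes "\<forall>\<^sub>F t in at_right 0. t \<in> F \<longrightarrow> Q t"
  obtains t where "t \<in> F" "t > 0" "Q t"
proof -
  obtain e where e: "e > 0" "\<And>t. 0 < t \<Longrightarrow> t < e \<Longrightarrow> t \<in> F \<longrightarrow> Q t"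
    using assms unfolding eventually_at_right_field by auto
  obtain n where "inverse (real (Suc n)) < e" using reals_Archimedean[OF e(1)] by blast
  moreover have "inverse (real (Suc n)) \<in> F" by (intro F_intros F_of_nat)
  ultimately show ?thesis using e(2) that by (metis inverse_positive_iff_positive of_nat_0_less_iff zero_less_Suc)
qed

definition has_slope :: "(real ^ 'n \<Rightarrow> real) \<Rightarrow> real ^ 'n \<Rightarrow> real ^ 'n \<Rightarrow> real \<Rightarrow> bool" where
  "has_slope f x v c \<longleftrightarrow> (\<forall>\<^sub>F t in at_right 0. t \<in> F \<longrightarrow> f (x + t *\<^sub>R v) = f x + c * t)"

definition slope :: "(real ^ 'n \<Rightarrow> real) \<Rightarrow> real ^ 'n \<Rightarrow> real ^ 'n \<Rightarrow> real" where
  "slope f x v = (THE c. has_slope f x v c)"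

lemma has_slope_unique:
  assumes "has_slope f x v c" "has_slope f x v d" shows "c = d"
proof -
  have "\<forall>\<^sub>F t in at_right 0. t \<in> F \<longrightarrow> c * t = d * t"
    using assms unfolding has_slope_def by eventually_elim auto
  then obtain t where "t > 0" "c * t = d * t" by (rule eventually_F_witness)
  then show ?thesis by simp
qed

lemma slope_eqI: "has_slope f x v c \<Longrightarrow> slope f x v = c"
  unfolding slope_def using has_slope_unique by blast

lemma line_polyhedral_has_slope:
  assumes "line_polyhedral S f" "x \<in> F_vecs" "v \<in> int_vecs" "x \<in> S"
    and feas: "\<forall>\<^sub>F t in at_right 0. x + t *\<^sub>R v \<in> S"
  shows "has_slope f x v (slope f x v)" "slope f x v \<in> \<int>"
proof -
  obtain \<Gamma> where \<Gamma>: "finite \<Gamma>" "\<Gamma> \<noteq> {}" "\<Gamma> \<subseteq> \<int> \<times> F"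
    "\<And>t c d. t \<in> F \<Longrightarrow> x + t *\<^sub>R v \<in> S \<Longrightarrow> (c, d) \<in> \<Gamma> \<Longrightarrow> c * t + d \<le> f (x + t *\<^sub>R v)"
    "\<And>t. t \<in> F \<Longrightarrow> x + t *\<^sub>R v \<in> S \<Longrightarrow> \<exists>(c, d)\<in>\<Gamma>. f (x + t *\<^sub>R v) = c * t + d"
    using line_polyhedralE[OF assms(1-3)] by metis
  define \<Gamma>0 where "\<Gamma>0 = {c. (c, f x) \<in> \<Gamma>}"
  have fin0: "finite \<Gamma>0" unfolding \<Gamma>0_def
    by (rule finite_subset[OF _ finite_imageI[OF \<Gamma>(1), of fst]]) force
  have ne0: "\<Gamma>0 \<noteq> {}" using \<Gamma>(5)[of 0] assms(4) by (auto simp: \<Gamma>0_def)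
  define c where "c = Max \<Gamma>0"
  have c: "(c, f x) \<in> \<Gamma>" and cmax: "\<And>c'. (c', f x) \<in> \<Gamma> \<Longrightarrow> c' \<le> c"
    using Max_in[OF fin0 ne0] Max_ge[OF fin0] by (auto simp: c_def \<Gamma>0_def)
  have "\<forall>\<^sub>F t in at_right 0. \<forall>y\<in>\<Gamma>. fst y * t + snd y \<le> c * t + f x"
  proof (intro eventually_ball_finite \<Gamma>(1) ballI)
    fix y assume y: "y \<in> \<Gamma>"
    have "snd y \<le> f x" using \<Gamma>(4)[of 0 "fst y" "snd y"] y assms(4) by simp
    then consider "snd y = f x" | "snd y < f x" by linarith
    then show "\<forall>\<^sub>F t in at_right 0. fst y * t + snd y \<le> c * t + f x"
    proof cases
      case 1
      then have "fst y \<le> c" using cmax[of "fst y"] y by (metis prod.collapse)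
      moreover have "\<forall>\<^sub>F t in at_right (0 :: real). t > 0" by (rule eventually_at_right_less)
      ultimately show ?thesis using 1 by (auto elim!: eventually_mono intro: mult_right_mono)
    next
      case 2
      from eventually_affine_less[OF 2, of "fst y" c] show ?thesis
        by eventually_elim (simp add: algebra_simps)
    qed
  qed
  with feas have "has_slope f x v c"
    unfolding has_slope_def
  proof eventually_elim
    case (elim t)
    show ?case
    proof
      assume t: "t \<in> F"
      then obtain c' d' where "(c', d') \<in> \<Gamma>" "f (x + t *\<^sub>R v) = c' * t + d'"
        using \<Gamma>(5) elim(1) by blast
      with elim(2) have "f (x + t *\<^sub>R v) \<le> c * t + f x" by fastforce
      with \<Gamma>(4)[OF t elim(1) c] show "f (x + t *\<^sub>R v) = f x + c * t" by simp
    qed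
  qed
  with slope_eqI[OF this] c \<Gamma>(3) show "has_slope f x v (slope f x v)" "slope f x v \<in> \<int>" by auto
qed

lemma slope_lower_bound:
  assumes "F_convex_on S f" "has_slope f x v c" "x \<in> F_vecs" "v \<in> int_vecs" "t \<in> F" "t \<ge> 0"
    "x \<in> S" "x + t *\<^sub>R v \<in> S"
  shows "f x + c * t \<le> f (x + t *\<^sub>R v)"
proof (cases "t = 0")
  case False
  then have t: "t > 0" using assms by simp
  have "\<forall>\<^sub>F \<tau> in at_right 0. 0 + 1 * \<tau> < t + 0 * \<tau>" by (rule eventually_affine_less[OF t])
  with assms(2) have "\<forall>\<^sub>F \<tau> in at_right 0. \<tau> \<in> F \<longrightarrow> \<tau> < t \<and> f (x + \<tau> *\<^sub>R v) = f x + c * \<tau>"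
    unfolding has_slope_def by eventually_elim auto
  then obtain \<tau> where \<tau>: "\<tau> \<in> F" "\<tau> > 0" "\<tau> < t" "f (x + \<tau> *\<^sub>R v) = f x + c * \<tau>"
    by (rule eventually_F_witness) auto
  have "f (x + (\<tau> / t * t) *\<^sub>R v) \<le> (1 - \<tau> / t) * f x + \<tau> / t * f (x + t *\<^sub>R v)"
    by (rule F_convex_onD[OF assms(1)]) (use \<tau> t assms in \<open>auto intro: F_intros\<close>)
  then have "f x + c * \<tau> \<le> (1 - \<tau> / t) * f x + \<tau> / t * f (x + t *\<^sub>R v)"
    using t \<tau> by simp
  then have "\<tau> * (f x + c * t) \<le> \<tau> * f (x + t *\<^sub>R v)"
    using t by (simp add: field_simps)
  then show ?thesis using t \<tau> by simp
qed auto

text \<open>The final slopes of the rays \<open>x + t v\<close> agree for all interior \<open>x\<close>: the point \<open>x + r w + T v\<close> is the midpoint of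
  \<open>x + 2 r w\<close> and \<open>x + 2 T v\<close>, whose difference is a multiple of an integral vector when \<open>T / r\<close> is an integer.
  Hence only an unbounded set of \<open>T\<close> can be controlled in one step.\<close>

lemma growth_bound_recession:
  fixes f :: "real ^ 'n \<Rightarrow> real"
  assumes I: "integral_system I" and f: "line_polyhedral (halfspaces_inter I) f"
    and v: "v \<in> int_vecs" "\<And>a b. (a, b) \<in> I \<Longrightarrow> a \<bullet> v \<ge> 0"
  shows "\<exists>M. \<forall>x \<in> F_vecs \<inter> open_halfspaces_inter I. \<forall>t\<in>F. 0 \<le> t \<longrightarrow> f (x + t *\<^sub>R v) \<le> f x + M * t"
proof (cases "open_halfspaces_inter I = {}")
  case False
  let ?V = "open_halfspaces_inter I"
  have V: "open ?V" "convex ?V"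
    using I open_halfspaces_inter_open open_halfspaces_inter_convex by (auto simp: integral_system_def)
  obtain x0 where x0: "x0 \<in> F_vecs" "x0 \<in> ?V" using F_vecs_dense[OF V(1) False] .
  have cvx: "F_convex_on (halfspaces_inter I) f"
    using f halfspaces_inter_convex by (rule line_polyhedral_F_convex_on)
  have inS: "x + t *\<^sub>R v \<in> halfspaces_inter I" if "x \<in> ?V" "t \<ge> 0" for x t
  proof -
    have "a \<bullet> (x + t *\<^sub>R v) + b \<ge> 0" if "(a, b) \<in> I" for a b
    proof -
      have "a \<bullet> x + b > 0" using \<open>x \<in> ?V\<close> that by (auto simp: open_halfspaces_inter_def)
      moreover have "t * (a \<bullet> v) \<ge> 0" using v(2)[OF that] \<open>t \<ge> 0\<close> by simp
      ultimately show ?thesis by (simp add: inner_add_right)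
    qed
    then show ?thesis by (auto simp: halfspaces_inter_def)
  qed
  obtain \<Gamma> where \<Gamma>: "finite \<Gamma>"
    "\<And>t. t \<in> F \<Longrightarrow> x0 + t *\<^sub>R v \<in> halfspaces_inter I \<Longrightarrow> \<exists>(c, d)\<in>\<Gamma>. f (x0 + t *\<^sub>R v) = c * t + d"
    using line_polyhedralE[OF f x0(1) v(1)] by metis
  define M where "M = Max (fst ` \<Gamma>)"
  define P where "P x \<longleftrightarrow> (\<exists>C. \<forall>B. \<exists>T\<in>F. T > B \<and> T > 0 \<and> f (x + T *\<^sub>R v) \<le> C + M * T)" for x
  have F_large: "\<exists>T\<in>F. T > B \<and> T > 0" for B
  proof -
    obtain n where "real n > max B 0" using reals_Archimedean2 by blast
    then show ?thesis by (intro bexI[of _ "real n"]) auto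
  qed
  have "P x0" unfolding P_def
  proof (intro exI allI)
    fix B obtain T where T: "T \<in> F" "T > B" "T > 0" using F_large by blast
    then obtain c d where cd: "(c, d) \<in> \<Gamma>" "f (x0 + T *\<^sub>R v) = c * T + d"
      using \<Gamma>(2)[OF T(1) inS[OF x0(2)]] by auto
    have "c \<le> M" "d \<le> Max (snd ` \<Gamma>)"
      unfolding M_def using cd(1) \<Gamma>(1) by (auto intro!: Max_ge rev_image_eqI)
    then have "c * T + d \<le> Max (snd ` \<Gamma>) + M * T"
      using mult_right_mono[OF \<open>c \<le> M\<close> less_imp_le[OF T(3)]] by linarith
    then show "\<exists>T\<in>F. T > B \<and> T > 0 \<and> f (x0 + T *\<^sub>R v) \<le> Max (snd ` \<Gamma>) + M * T"
      using cd T by auto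
  qed
  have bound: "f (x + t *\<^sub>R v) \<le> f x + M * t"
    if x: "x \<in> F_vecs" "x \<in> ?V" "P x" and t: "t \<in> F" "t \<ge> 0" for x t
  proof (rule ccontr)
    assume neg: "\<not> ?thesis"
    define \<epsilon> where "\<epsilon> = f (x + t *\<^sub>R v) - (f x + M * t)"
    have \<epsilon>: "\<epsilon> > 0" using neg by (simp add: \<epsilon>_def)
    obtain C where C: "\<And>B. \<exists>T\<in>F. T > B \<and> T > 0 \<and> f (x + T *\<^sub>R v) \<le> C + M * T"
      using x(3) unfolding P_def by blast
    obtain T where T: "T \<in> F" "T > max t (t * \<bar>C - f x\<bar> / \<epsilon>)" "T > 0" "f (x + T *\<^sub>R v) \<le> C + M * T"
      using C by blast
    have "f (x + (t / T * T) *\<^sub>R v) \<le> (1 - t / T) * f x + t / T * f (x + T *\<^sub>R v)"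
      by (rule F_convex_onD[OF cvx])
        (use x t T v inS[of x T] open_halfspaces_inter_subset in \<open>auto intro: F_intros\<close>)
    also have "\<dots> \<le> (1 - t / T) * f x + t / T * (C + M * T)"
      using T t by (intro add_left_mono mult_left_mono) auto
    also have "t / T * (C + M * T) = t / T * C + M * t" using T by (simp add: field_simps)
    finally have "\<epsilon> \<le> t / T * (C - f x)" using T by (simp add: \<epsilon>_def algebra_simps)
    then have "\<epsilon> * T \<le> t * (C - f x)" using T by (simp add: field_simps)
    also have "\<dots> \<le> t * \<bar>C - f x\<bar>" using t by (intro mult_left_mono) auto
    also have "\<dots> < \<epsilon> * T" using T \<epsilon> by (simp add: field_simps)
    finally show False by simp
  qed
  have "P y" if y: "y \<in> F_vecs" "y \<in> ?V" for y
  proof (rule rational_chain[where P = P, OF V _ x0 \<open>P x0\<close> y])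
    fix x r w assume x: "x \<in> F_vecs" "r \<in> F" "w \<in> int_vecs" "x \<in> ?V" "x + r *\<^sub>R w \<in> ?V"
      "x + (2 * r) *\<^sub>R w \<in> ?V" "P x"
    let ?z = "x + (2 * r) *\<^sub>R w"
    show "P (x + r *\<^sub>R w)"
    proof (cases "r = 0")
      case False
      show ?thesis unfolding P_def
      proof (intro exI allI)
        fix B
        obtain n where n: "real n > max (B / \<bar>r\<bar>) 0" using reals_Archimedean2 by blast
        define k where "k = sgn r * real n"
        have k: "k \<in> \<int>" by (auto simp: k_def sgn_if)
        have rk: "r * k = \<bar>r\<bar> * real n" by (simp add: k_def abs_sgn)
        define T where "T = r * k"
        have "T \<in> F" using x(2) Ints_subset_F[OF k] by (simp add: T_def F_mult)
        moreover have "T > B" "T > 0"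
          using n False unfolding T_def rk by (auto simp: field_simps)
        ultimately have T: "T \<in> F" "T > B" "T > 0" .
        have e1: "?z + (2 * r) *\<^sub>R (k *\<^sub>R v - w) = x + (2 * T) *\<^sub>R v"
          by (simp add: T_def algebra_simps)
        have e2: "?z + (1 / 2 * (2 * r)) *\<^sub>R (k *\<^sub>R v - w) = x + r *\<^sub>R w + T *\<^sub>R v"
          by (simp add: T_def vec_eq_iff algebra_simps)
        have "f (?z + (1 / 2 * (2 * r)) *\<^sub>R (k *\<^sub>R v - w))
            \<le> (1 - 1 / 2) * f ?z + 1 / 2 * f (?z + (2 * r) *\<^sub>R (k *\<^sub>R v - w))"
        proof (rule F_convex_onD[OF cvx])
          show "?z \<in> F_vecs" "k *\<^sub>R v - w \<in> int_vecs" "2 * r \<in> F" "1 / 2 \<in> F"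
            using x v k by (auto intro!: F_vecs_shift F_intros int_vecs_intros)
          show "?z \<in> halfspaces_inter I" using x open_halfspaces_inter_subset by blast
          show "?z + (2 * r) *\<^sub>R (k *\<^sub>R v - w) \<in> halfspaces_inter I"
            unfolding e1 using x T by (intro inS) auto
        qed auto
        then have "f (x + r *\<^sub>R w + T *\<^sub>R v) \<le> (f ?z + f (x + (2 * T) *\<^sub>R v)) / 2"
          unfolding e1 e2 by simp
        moreover have "f (x + (2 * T) *\<^sub>R v) \<le> f x + M * (2 * T)"
          using x T by (intro bound) (auto intro!: F_intros)
        ultimately have "f (x + r *\<^sub>R w + T *\<^sub>R v) \<le> (f ?z + f x) / 2 + M * T" by (simp add: field_simps)
        then show "\<exists>T\<in>F. T > B \<and> T > 0 \<and> f (x + r *\<^sub>R w + T *\<^sub>R v) \<le> (f ?z + f x) / 2 + M * T"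
          using T by blast
      qed
    qed (use x in simp)
  qed
  then show ?thesis using bound by blast
qed auto

text \<open>On the cells of the facet where \<open>f\<close> is affine, the slope of \<open>f\<close> in the direction \<open>- v\<close> is integer-valued and
  inherits convexity from \<open>f\<close>. The set \<open>U\<close> consists of the points through which a line in direction \<open>v\<close> leaves the interior.\<close>

lemma exit_slope_bounded_below:
  fixes f :: "real ^ 'n \<Rightarrow> real"
  assumes I: "integral_system I" and f: "line_polyhedral (halfspaces_inter I) f"
    and ab0: "(a0, b0) \<in> I" and v: "v \<in> int_vecs"
    and K: "integral_system K" "K \<noteq> {}"
      "\<And>x. x \<in> F_vecs \<Longrightarrow> x \<in> halfspaces_inter I \<Longrightarrow> a0 \<bullet> x + b0 = 0 \<Longrightarrow> f x = max_affine K x"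
  shows "\<exists>c. \<forall>z. z \<in> F_vecs \<and> z \<in> halfspaces_inter I \<and> a0 \<bullet> z + b0 = 0 \<and>
    z \<in> open_halfspaces_inter {(a, b)\<in>I. a \<bullet> v \<ge> 0} \<longrightarrow> c \<le> slope f z (- v)"
proof -
  define U where "U = open_halfspaces_inter {(a, b)\<in>I. a \<bullet> v \<ge> 0}"
  define q where "q z = slope f z (- v)" for z
  have finI: "finite I" using I by (simp add: integral_system_def)
  have finK: "finite K" using K by (simp add: integral_system_def)
  have U: "open U" "convex U"
    unfolding U_def using finI
    by (auto intro!: open_halfspaces_inter_open open_halfspaces_inter_convex elim: rev_finite_subset)
  have cvx: "F_convex_on (halfspaces_inter I) f"
    using f halfspaces_inter_convex by (rule line_polyhedral_F_convex_on)
  have feas: "\<forall>\<^sub>F t in at_right 0. z + t *\<^sub>R (- v) \<in> halfspaces_inter I" if "z \<in> halfspaces_inter I" "z \<in> U" for z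
  proof (rule halfspaces_inter_feasible[OF finI that(1)])
    show "a \<bullet> z + b > 0 \<or> a \<bullet> - v \<ge> 0" if "(a, b) \<in> I" for a b
    proof (cases "a \<bullet> v \<ge> 0")
      case True
      with that have "(a, b) \<in> {(a, b)\<in>I. a \<bullet> v \<ge> 0}" by simp
      with \<open>z \<in> U\<close> show ?thesis unfolding U_def open_halfspaces_inter_def by blast
    qed auto
  qed
  have slope: "has_slope f z (- v) (q z)" "q z \<in> \<int>"
    if "z \<in> F_vecs" "z \<in> halfspaces_inter I" "z \<in> U" for z
    unfolding q_def using that v by (auto intro!: line_polyhedral_has_slope[OF f] feas int_vecs_uminus)
  define J where "J = (\<lambda>(a, b). I \<union> {(a0, b0), (- a0, - b0)} \<union> (\<lambda>(a', b'). (a - a', b - b')) ` K)"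
  have J: "x \<in> halfspaces_inter (J (a, b)) \<longleftrightarrow> x \<in> halfspaces_inter I \<and> a0 \<bullet> x + b0 = 0 \<and>
      (\<forall>(a', b')\<in>K. a' \<bullet> x + b' \<le> a \<bullet> x + b)" for a b x
  proof -
    have "- a0 \<bullet> x + - b0 \<ge> 0 \<longleftrightarrow> a0 \<bullet> x + b0 \<le> 0" by auto
    moreover have "(a - a') \<bullet> x + (b - b') \<ge> 0 \<longleftrightarrow> a' \<bullet> x + b' \<le> a \<bullet> x + b" for a' b'
      by (auto simp: inner_diff_left)
    ultimately show ?thesis
      unfolding J_def halfspaces_inter_def by (auto simp: ball_Un case_prod_beta)
  qed
  have sysJ: "integral_system (J y)" if "y \<in> K" for y
  proof -
    have "y' \<in> K \<Longrightarrow> (fst y - fst y', snd y - snd y') \<in> int_vecs \<times> F" for y'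
      using K(1) that by (auto simp: integral_system_def intro!: int_vecs_diff F_diff)
    moreover have "{(a0, b0), (- a0, - b0)} \<subseteq> int_vecs \<times> F"
      using I ab0 by (auto simp: integral_system_def intro!: int_vecs_uminus F_uminus)
    ultimately show ?thesis
      using I finK by (auto simp: integral_system_def J_def case_prod_beta)
  qed
  have "\<exists>c. \<forall>z. z \<in> F_vecs \<inter> (halfspaces_inter (J y) \<inter> U) \<longrightarrow> c \<le> q z" if y: "y \<in> K" for y
  proof -
    obtain a b where ab: "y = (a, b)" by (cases y)
    have fval: "f x = a \<bullet> x + b" if "x \<in> F_vecs" "x \<in> halfspaces_inter (J y)" for x
      using that J[of x a b] y ab K(3)[of x] max_affine_eqI[OF finK, of x "a \<bullet> x + b" a b] by auto
    have sub: "halfspaces_inter (J y) \<subseteq> halfspaces_inter I" using J ab by blast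
    have "\<exists>c. \<forall>z \<in> F_vecs \<inter> (halfspaces_inter (J y) \<inter> U). c \<le> q z"
    proof (rule integer_convex_bounded_below[OF sysJ[OF y] U])
      show "q x \<in> \<int>" if "x \<in> F_vecs" "x \<in> halfspaces_inter (J y) \<inter> U" for x
        using that sub by (auto intro: slope(2))
      show "F_convex_on (halfspaces_inter (J y) \<inter> U) q"
        unfolding F_convex_on_def
      proof (intro ballI impI)
        fix x w t s assume *: "x \<in> F_vecs" "w \<in> int_vecs" "t \<in> F" "s \<in> F" "0 \<le> s" "s \<le> 1"
          "x \<in> halfspaces_inter (J y) \<inter> U" "x + t *\<^sub>R w \<in> halfspaces_inter (J y) \<inter> U"
        let ?x' = "x + t *\<^sub>R w" and ?m = "x + (s * t) *\<^sub>R w"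
        have "(1 - s) *\<^sub>R x + s *\<^sub>R ?x' \<in> halfspaces_inter (J y) \<inter> U"
          using * U(2) halfspaces_inter_convex[of "J y"] by (intro convexD convex_Int) auto
        moreover have "(1 - s) *\<^sub>R x + s *\<^sub>R ?x' = ?m" by (simp add: algebra_simps)
        ultimately have m: "?m \<in> halfspaces_inter (J y) \<inter> U" by simp
        have inF: "?x' \<in> F_vecs" "?m \<in> F_vecs" using * by (auto intro!: F_vecs_shift F_intros)
        have "has_slope f x (- v) (q x)" "has_slope f ?x' (- v) (q ?x')" "has_slope f ?m (- v) (q ?m)"
          using *(1,7,8) m inF sub by (auto intro!: slope(1))
        moreover have "\<forall>\<^sub>F t in at_right 0. x + t *\<^sub>R (- v) \<in> halfspaces_inter I"
          "\<forall>\<^sub>F t in at_right 0. ?x' + t *\<^sub>R (- v) \<in> halfspaces_inter I"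
          using *(7,8) sub by (auto intro!: feas simp del: scaleR_minus_right)
        ultimately have "\<forall>\<^sub>F \<tau> in at_right 0. \<tau> \<in> F \<longrightarrow>
            f (x + \<tau> *\<^sub>R (- v)) = f x + q x * \<tau> \<and> f (?x' + \<tau> *\<^sub>R (- v)) = f ?x' + q ?x' * \<tau> \<and>
            f (?m + \<tau> *\<^sub>R (- v)) = f ?m + q ?m * \<tau> \<and>
            x + \<tau> *\<^sub>R (- v) \<in> halfspaces_inter I \<and> ?x' + \<tau> *\<^sub>R (- v) \<in> halfspaces_inter I"
          unfolding has_slope_def by eventually_elim simp
        then obtain \<tau> where \<tau>: "\<tau> \<in> F" "\<tau> > 0"
          "f (x + \<tau> *\<^sub>R (- v)) = f x + q x * \<tau>" "f (?x' + \<tau> *\<^sub>R (- v)) = f ?x' + q ?x' * \<tau>"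
          "f (?m + \<tau> *\<^sub>R (- v)) = f ?m + q ?m * \<tau>"
          "x + \<tau> *\<^sub>R (- v) \<in> halfspaces_inter I" "?x' + \<tau> *\<^sub>R (- v) \<in> halfspaces_inter I"
          by (rule eventually_F_witness) auto
        have e: "?x' + \<tau> *\<^sub>R (- v) = (x + \<tau> *\<^sub>R (- v)) + t *\<^sub>R w"
          "?m + \<tau> *\<^sub>R (- v) = (x + \<tau> *\<^sub>R (- v)) + (s * t) *\<^sub>R w" by simp_all
        have "f (?m + \<tau> *\<^sub>R (- v)) \<le> (1 - s) * f (x + \<tau> *\<^sub>R (- v)) + s * f (?x' + \<tau> *\<^sub>R (- v))"
          unfolding e using * \<tau>(1,2,6,7)[unfolded e] v
          by (intro F_convex_onD[OF cvx] F_vecs_shift int_vecs_uminus)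
        moreover have "f ?m = (1 - s) * f x + s * f ?x'"
          using fval[of x] fval[of ?x'] fval[of ?m] * m inF
          by (auto simp: inner_add_right algebra_simps)
        ultimately have "\<tau> * q ?m \<le> \<tau> * ((1 - s) * q x + s * q ?x')"
          unfolding \<tau>(3-5) by (simp add: algebra_simps)
        then show "q ?m \<le> (1 - s) * q x + s * q ?x'" using \<tau>(2) by simp
      qed
    qed
    then show ?thesis by blast
  qed
  from finite_uniform_lower_bound[where R = "\<lambda>y z. z \<in> F_vecs \<inter> (halfspaces_inter (J y) \<inter> U)", OF finK this]
  obtain c where c: "\<forall>y\<in>K. \<forall>z. z \<in> F_vecs \<inter> (halfspaces_inter (J y) \<inter> U) \<longrightarrow> c \<le> q z"
    by blast
  have "c \<le> q z" if z: "z \<in> F_vecs" "z \<in> halfspaces_inter I" "a0 \<bullet> z + b0 = 0" "z \<in> U" for z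
  proof -
    obtain a b where ab: "(a, b) \<in> K" "max_affine K z = a \<bullet> z + b"
      using max_affine_attained[OF finK K(2)] .
    then have "z \<in> halfspaces_inter (J (a, b))"
      unfolding J using z max_affine_ge[OF finK, of _ _ z] by auto
    with c ab z show ?thesis by blast
  qed
  then show ?thesis unfolding q_def U_def by blast
qed

lemma growth_bound_exit:
  fixes f :: "real ^ 'n \<Rightarrow> real"
  assumes I: "integral_system I" and f: "line_polyhedral (halfspaces_inter I) f"
    and v: "v \<in> int_vecs" "(a1, b1) \<in> I" "a1 \<bullet> v < 0"
    and facets: "\<And>a b. (a, b) \<in> I \<Longrightarrow> \<exists>K. integral_system K \<and> K \<noteq> {} \<and>
      (\<forall>x\<in>F_vecs. x \<in> halfspaces_inter I \<longrightarrow> a \<bullet> x + b = 0 \<longrightarrow> f x = max_affine K x)"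
  shows "\<exists>M. \<forall>x \<in> F_vecs \<inter> open_halfspaces_inter I. \<forall>t\<in>F. 0 \<le> t \<longrightarrow>
    x + t *\<^sub>R v \<in> halfspaces_inter I \<longrightarrow> f (x + t *\<^sub>R v) \<le> f x + M * t"
proof -
  let ?U = "open_halfspaces_inter {(a, b)\<in>I. a \<bullet> v \<ge> 0}"
  have finI: "finite I" using I by (simp add: integral_system_def)
  have cvx: "F_convex_on (halfspaces_inter I) f"
    using f halfspaces_inter_convex by (rule line_polyhedral_F_convex_on)
  have "\<exists>c. \<forall>z. z \<in> F_vecs \<and> z \<in> halfspaces_inter I \<and> fst y \<bullet> z + snd y = 0 \<and> z \<in> ?U \<longrightarrow>
      c \<le> slope f z (- v)" if y: "y \<in> I" for y
  proof -
    have yI: "(fst y, snd y) \<in> I" using y by simp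
    obtain K where "integral_system K" "K \<noteq> {}"
      "\<And>x. x \<in> F_vecs \<Longrightarrow> x \<in> halfspaces_inter I \<Longrightarrow> fst y \<bullet> x + snd y = 0 \<Longrightarrow> f x = max_affine K x"
      using facets[OF yI] by blast
    then show ?thesis by (rule exit_slope_bounded_below[OF I f yI v(1)])
  qed
  from finite_uniform_lower_bound[where R = "\<lambda>y z. z \<in> F_vecs \<and> z \<in> halfspaces_inter I \<and>
      fst y \<bullet> z + snd y = 0 \<and> z \<in> ?U", OF finI this]
  obtain c where c: "\<forall>y\<in>I. \<forall>z. z \<in> F_vecs \<and>
      z \<in> halfspaces_inter I \<and> fst y \<bullet> z + snd y = 0 \<and> z \<in> ?U \<longrightarrow> c \<le> slope f z (- v)" by blast
  have "f (x + t *\<^sub>R v) \<le> f x + - c * t" if x: "x \<in> F_vecs" "x \<in> open_halfspaces_inter I"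
    and t: "t \<in> F" "0 \<le> t" "x + t *\<^sub>R v \<in> halfspaces_inter I" for x t
  proof -
    define N where "N = {y \<in> I. fst y \<bullet> v < 0}"
    define \<theta> where "\<theta> = (\<lambda>y. (fst y \<bullet> x + snd y) / - (fst y \<bullet> v))"
    define T where "T = Min (\<theta> ` N)"
    have N: "finite N" "N \<noteq> {}" using finI v by (auto simp: N_def)
    have "T \<in> \<theta> ` N" unfolding T_def using N by (intro Min_in) auto
    then obtain y where y: "y \<in> N" "T = \<theta> y" by blast
    have Tle: "T \<le> \<theta> y'" if "y' \<in> N" for y' unfolding T_def using that N by (intro Min_le) auto
    have xpos: "fst y' \<bullet> x + snd y' > 0" if "y' \<in> I" for y'
      using x that by (auto simp: open_halfspaces_inter_def case_prod_beta)
    have yv: "fst y \<bullet> v < 0" "y \<in> I" using y by (auto simp: N_def)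
    have Tpos: "T > 0" unfolding y(2) \<theta>_def using yv xpos[OF yv(2)] by (intro divide_pos_pos) auto
    have y_int: "fst y \<in> int_vecs" "snd y \<in> F" using I yv(2) by (auto simp: integral_system_def)
    have TF: "T \<in> F" unfolding y(2) \<theta>_def using y_int x v(1)
      by (intro F_divide F_uminus F_add F_inner) (auto intro: int_vecs_subset)
    define z where "z = x + T *\<^sub>R v"
    have zF: "z \<in> F_vecs" unfolding z_def using x TF v by (intro F_vecs_shift)
    have z0: "fst y \<bullet> z + snd y = 0"
    proof -
      have "T * (fst y \<bullet> v) = - (fst y \<bullet> x + snd y)" using yv by (simp add: y(2) \<theta>_def)
      then show ?thesis by (simp add: z_def inner_add_right)
    qed
    have zU: "fst y' \<bullet> z + snd y' > 0" if "y' \<in> I" "fst y' \<bullet> v \<ge> 0" for y'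
    proof -
      have "0 \<le> T * (fst y' \<bullet> v)" using that Tpos by simp
      then have "0 < (fst y' \<bullet> x + snd y') + T * (fst y' \<bullet> v)" by (rule add_pos_nonneg[OF xpos[OF that(1)]])
      then show ?thesis by (simp add: z_def inner_add_right algebra_simps)
    qed
    have zN: "fst y' \<bullet> z + snd y' \<ge> 0" if "y' \<in> I" "fst y' \<bullet> v < 0" for y'
      using Tle[of y'] that by (simp add: N_def \<theta>_def z_def inner_add_right field_simps)
    have zS: "z \<in> halfspaces_inter I"
      using zU zN unfolding halfspaces_inter_def by (auto simp: case_prod_beta) (meson less_imp_le not_le)
    have zU': "z \<in> ?U" using zU unfolding open_halfspaces_inter_def by auto
    have tT: "t \<le> T"
    proof -
      have "fst y \<bullet> (x + t *\<^sub>R v) + snd y \<ge> 0"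
        using t yv(2) by (auto simp: halfspaces_inter_def case_prod_beta)
      then show ?thesis using yv(1) by (simp add: y(2) \<theta>_def inner_add_right field_simps)
    qed
    let ?q = "slope f z (- v)"
    have cq: "c \<le> ?q" using c yv(2) zF zS z0 zU' by blast
    have feas: "\<forall>\<^sub>F \<tau> in at_right 0. z + \<tau> *\<^sub>R (- v) \<in> halfspaces_inter I"
    proof (rule halfspaces_inter_feasible[OF finI zS])
      show "a \<bullet> z + b > 0 \<or> a \<bullet> - v \<ge> 0" if "(a, b) \<in> I" for a b
        using zU[of "(a, b)"] that by (cases "a \<bullet> v \<ge> 0") auto
    qed
    have xS: "x \<in> halfspaces_inter I" using x open_halfspaces_inter_subset by blast
    have ze: "z + T *\<^sub>R (- v) = x" by (simp add: z_def)
    have "f z + ?q * T \<le> f (z + T *\<^sub>R (- v))"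
    proof (rule slope_lower_bound[OF cvx])
      show "has_slope f z (- v) ?q"
        using line_polyhedral_has_slope(1)[OF f zF int_vecs_uminus[OF v(1)] zS feas] .
    qed (use zF v(1) TF Tpos zS xS ze in \<open>auto intro: int_vecs_uminus\<close>)
    then have fz: "f z + ?q * T \<le> f x" unfolding ze .
    have "f (x + (t / T * T) *\<^sub>R v) \<le> (1 - t / T) * f x + t / T * f (x + T *\<^sub>R v)"
      by (rule F_convex_onD[OF cvx])
        (use x v(1) TF t tT Tpos xS zS in \<open>auto simp: z_def intro: F_intros\<close>)
    also have "\<dots> \<le> (1 - t / T) * f x + t / T * (f x - ?q * T)"
      using fz t Tpos by (intro add_left_mono mult_left_mono) (auto simp: z_def)
    also have "\<dots> = f x + - ?q * t" using Tpos by (simp add: field_simps)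
    also have "\<dots> \<le> f x + - c * t" using cq t by (intro add_left_mono mult_right_mono) auto
    finally show ?thesis using Tpos by simp
  qed
  then show ?thesis by blast
qed

lemma growth_bound:
  fixes f :: "real ^ 'n \<Rightarrow> real"
  assumes I: "integral_system I" and f: "line_polyhedral (halfspaces_inter I) f"
    and v: "v \<in> int_vecs"
    and facets: "\<And>a b. (a, b) \<in> I \<Longrightarrow> \<exists>K. integral_system K \<and> K \<noteq> {} \<and>
      (\<forall>x\<in>F_vecs. x \<in> halfspaces_inter I \<longrightarrow> a \<bullet> x + b = 0 \<longrightarrow> f x = max_affine K x)"
  shows "\<exists>M. \<forall>x \<in> F_vecs \<inter> open_halfspaces_inter I. \<forall>t\<in>F. 0 \<le> t \<longrightarrow>
    x + t *\<^sub>R v \<in> halfspaces_inter I \<longrightarrow> f (x + t *\<^sub>R v) \<le> f x + M * t"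
proof (cases "\<exists>(a, b)\<in>I. a \<bullet> v < 0")
  case True
  then show ?thesis using growth_bound_exit[OF I f v _ _ facets] by blast
next
  case False
  have "\<exists>M. \<forall>x \<in> F_vecs \<inter> open_halfspaces_inter I. \<forall>t\<in>F. 0 \<le> t \<longrightarrow> f (x + t *\<^sub>R v) \<le> f x + M * t"
    by (rule growth_bound_recession[OF I f v]) (use False in force)
  then show ?thesis by blast
qed

end

locale bounded_growth = subfield_of_reals F for F +
  fixes I :: "((real ^ 'n) \<times> real) set" and f :: "real ^ 'n \<Rightarrow> real" and M :: real
  assumes system: "integral_system I"
    and lines: "line_polyhedral (halfspaces_inter I) f"
    and nonempty: "open_halfspaces_inter I \<noteq> {}"
    and M_nonneg: "M \<ge> 0"
    and growth: "x \<in> F_vecs \<Longrightarrow> x \<in> open_halfspaces_inter I \<Longrightarrow> t \<in> F \<Longrightarrow> 0 \<le> t \<Longrightarrow>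
      v = axis i 1 \<or> v = - axis i 1 \<Longrightarrow> x + t *\<^sub>R v \<in> halfspaces_inter I \<Longrightarrow>
      f (x + t *\<^sub>R v) \<le> f x + M * t"
begin

abbreviation V :: "(real ^ 'n) set" where "V \<equiv> open_halfspaces_inter I"

lemma V_open: "open V"
  using system open_halfspaces_inter_open by (auto simp: integral_system_def)

lemma convex_f: "F_convex_on (halfspaces_inter I) f"
  using lines halfspaces_inter_convex by (rule line_polyhedral_F_convex_on)

lemma V_subset: "x \<in> V \<Longrightarrow> x \<in> halfspaces_inter I"
  using open_halfspaces_inter_subset by blast

lemma slope_in_V:
  assumes "x \<in> F_vecs" "x \<in> V" "v \<in> int_vecs"
  shows "has_slope f x v (slope f x v)" "slope f x v \<in> \<int>"
proof -
  have "\<forall>\<^sub>F t in at_right 0. x + t *\<^sub>R v \<in> halfspaces_inter I"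
    using open_feasible[OF V_open assms(2), of v] by eventually_elim (rule V_subset)
  then show "has_slope f x v (slope f x v)" "slope f x v \<in> \<int>"
    using assms V_subset by (auto intro!: line_polyhedral_has_slope[OF lines])
qed

lemma slope_below:
  assumes "x \<in> F_vecs" "x \<in> V" "v \<in> int_vecs" "t \<in> F" "t \<ge> 0" "x + t *\<^sub>R v \<in> halfspaces_inter I"
  shows "f x + slope f x v * t \<le> f (x + t *\<^sub>R v)"
  using assms V_subset by (intro slope_lower_bound[OF convex_f slope_in_V(1)]) auto

lemma axis_step:
  assumes x: "x \<in> F_vecs" "x \<in> V" and t: "t \<in> F" "x + t *\<^sub>R axis i 1 \<in> V"
  shows "\<bar>f (x + t *\<^sub>R axis i 1) - f x\<bar> \<le> M * \<bar>t\<bar>"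
proof -
  have *: "f (z + s *\<^sub>R v) \<le> f z + M * s \<and> f z \<le> f (z + s *\<^sub>R v) + M * s"
    if "z \<in> F_vecs" "z \<in> V" "s \<in> F" "s \<ge> 0" "v = axis i 1 \<or> v = - axis i 1" "z + s *\<^sub>R v \<in> V" for z s v
  proof
    show "f (z + s *\<^sub>R v) \<le> f z + M * s" using that by (intro growth V_subset)
    have v: "v \<in> int_vecs" using that(5) by (auto intro: int_vecs_intros)
    have e: "z + s *\<^sub>R v + s *\<^sub>R (- v) = z" by simp
    have "f (z + s *\<^sub>R v + s *\<^sub>R (- v)) \<le> f (z + s *\<^sub>R v) + M * s"
      by (rule growth[where i = i]) (use that v e V_subset in \<open>auto intro: F_vecs_shift\<close>)
    then show "f z \<le> f (z + s *\<^sub>R v) + M * s" unfolding e .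
  qed
  show ?thesis
  proof (cases "t \<ge> 0")
    case True
    then show ?thesis using *[of x t "axis i 1"] assms by auto
  next
    case False
    then show ?thesis using *[of x "- t" "- axis i 1"] F_uminus[OF t(1)] assms by auto
  qed
qed

lemma lipschitz_near:
  assumes x: "x \<in> F_vecs" and e: "ball x e \<subseteq> V" and y: "y \<in> F_vecs" "y \<in> ball x e"
  shows "\<bar>f y - f x\<bar> \<le> M * (\<Sum>i\<in>UNIV. \<bar>y $ i - x $ i\<bar>)"
proof -
  define Z where "Z A = (\<chi> i. if i \<in> A then y $ i else x $ i)" for A
  have ZF: "Z A \<in> F_vecs" for A using x y by (auto simp: Z_def rational_points_def)
  have ZV: "Z A \<in> V" for A
  proof -
    have "norm (Z A - x) \<le> norm (y - x)" by (rule norm_le_componentwise_cart) (auto simp: Z_def)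
    then show ?thesis using e y by (auto simp: dist_norm norm_minus_commute subset_iff)
  qed
  have "\<bar>f (Z A) - f x\<bar> \<le> M * (\<Sum>i\<in>A. \<bar>y $ i - x $ i\<bar>)" if "finite A" for A
    using that
  proof (induction A rule: finite_induct)
    case empty
    then show ?case by (simp add: Z_def)
  next
    case (insert i A)
    let ?r = "y $ i - x $ i"
    have Z: "Z (insert i A) = Z A + ?r *\<^sub>R axis i 1"
      using insert by (auto simp: Z_def vec_eq_iff axis_def)
    have "?r \<in> F" using x y by (auto simp: rational_points_def intro: F_diff)
    then have "\<bar>f (Z (insert i A)) - f (Z A)\<bar> \<le> M * \<bar>?r\<bar>"
      using ZV[of "insert i A"] ZF ZV unfolding Z by (intro axis_step)
    with insert show ?case by (simp add: distrib_left)
  qed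
  from this[of UNIV] show ?thesis by (simp add: Z_def)
qed

lemma lipschitz_near_norm:
  assumes "x \<in> F_vecs" "ball x e \<subseteq> V" "y \<in> F_vecs" "y \<in> ball x e"
  shows "\<bar>f y - f x\<bar> \<le> M * real CARD('n) * norm (y - x)"
proof -
  have "(\<Sum>i\<in>UNIV. \<bar>y $ i - x $ i\<bar>) \<le> (\<Sum>i\<in>(UNIV::'n set). norm (y - x))"
    using component_le_norm_cart[of "y - x"] by (intro sum_mono) auto
  then have "M * (\<Sum>i\<in>UNIV. \<bar>y $ i - x $ i\<bar>) \<le> M * (real CARD('n) * norm (y - x))"
    using M_nonneg by (intro mult_left_mono) auto
  with lipschitz_near[OF assms] show ?thesis by (simp add: mult.assoc)
qed

lemma slope_add:
  assumes x: "x \<in> F_vecs" "x \<in> V" and uv: "u \<in> int_vecs" "v \<in> int_vecs"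
  shows "slope f x (u + v) \<le> slope f x u + slope f x v"
proof -
  have double: "\<forall>\<^sub>F t in at_right 0. t \<in> F \<longrightarrow> f (x + (2 * t) *\<^sub>R w) = f x + slope f x w * (2 * t)"
    if w: "w \<in> int_vecs" for w
  proof -
    obtain e where e: "e > 0" "\<And>t. 0 < t \<Longrightarrow> t < e \<Longrightarrow> t \<in> F \<longrightarrow> f (x + t *\<^sub>R w) = f x + slope f x w * t"
      using slope_in_V(1)[OF x w] unfolding has_slope_def eventually_at_right_field by auto
    show ?thesis unfolding eventually_at_right_field
    proof (intro exI conjI allI impI)
      show "0 < e / 2" using e by simp
      fix t assume "0 < t" "t < e / 2" "t \<in> F"
      then show "f (x + (2 * t) *\<^sub>R w) = f x + slope f x w * (2 * t)"
        using e(2)[of "2 * t"] by (simp add: F_mult)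
    qed
  qed
  have feas: "\<forall>\<^sub>F t in at_right 0. x + (2 * t) *\<^sub>R w \<in> V" for w
    using open_feasible[OF V_open x(2), of "2 *\<^sub>R w"] by (simp add: mult.commute)
  have "\<forall>\<^sub>F t in at_right 0. t \<in> F \<longrightarrow> f (x + (2 * t) *\<^sub>R u) = f x + slope f x u * (2 * t) \<and>
      f (x + (2 * t) *\<^sub>R v) = f x + slope f x v * (2 * t) \<and>
      f (x + t *\<^sub>R (u + v)) = f x + slope f x (u + v) * t \<and> x + (2 * t) *\<^sub>R u \<in> V \<and> x + (2 * t) *\<^sub>R v \<in> V"
    using double[OF uv(1)] double[OF uv(2)] slope_in_V(1)[OF x int_vecs_add[OF uv], unfolded has_slope_def]
      feas[of u] feas[of v] by eventually_elim blast
  then obtain t where t: "t \<in> F" "t > 0" "f (x + (2 * t) *\<^sub>R u) = f x + slope f x u * (2 * t)"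
      "f (x + (2 * t) *\<^sub>R v) = f x + slope f x v * (2 * t)"
      "f (x + t *\<^sub>R (u + v)) = f x + slope f x (u + v) * t" "x + (2 * t) *\<^sub>R u \<in> V" "x + (2 * t) *\<^sub>R v \<in> V"
    by (rule eventually_F_witness) auto
  let ?z = "x + (2 * t) *\<^sub>R u"
  have e: "?z + (2 * t) *\<^sub>R (v - u) = x + (2 * t) *\<^sub>R v" "?z + (1 / 2 * (2 * t)) *\<^sub>R (v - u) = x + t *\<^sub>R (u + v)"
    by (simp_all add: vec_eq_iff algebra_simps)
  have "f (?z + (1 / 2 * (2 * t)) *\<^sub>R (v - u)) \<le> (1 - 1 / 2) * f ?z + 1 / 2 * f (?z + (2 * t) *\<^sub>R (v - u))"
  proof (rule F_convex_onD[OF convex_f])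
    show "?z \<in> F_vecs" "v - u \<in> int_vecs" "2 * t \<in> F" "1 / 2 \<in> F"
      using x uv t(1) by (auto intro!: F_vecs_shift F_intros int_vecs_intros)
    show "?z \<in> halfspaces_inter I" "?z + (2 * t) *\<^sub>R (v - u) \<in> halfspaces_inter I"
      unfolding e using t by (auto intro: V_subset)
  qed auto
  then have "t * slope f x (u + v) \<le> t * (slope f x u + slope f x v)"
    unfolding e t(3-5) by (simp add: field_simps)
  then show ?thesis using t(2) by simp
qed

lemma slope_zero: "slope f x 0 = 0"
  by (rule slope_eqI) (simp add: has_slope_def)

lemma slope_scale_le:
  assumes x: "x \<in> F_vecs" "x \<in> V" and v: "v \<in> int_vecs"
  shows "slope f x (real k *\<^sub>R v) \<le> real k * slope f x v"
proof (induction k)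
  case (Suc k)
  have "slope f x (real k *\<^sub>R v + v) \<le> slope f x (real k *\<^sub>R v) + slope f x v"
    using x v by (intro slope_add int_vecs_scaleR) auto
  with Suc show ?case by (simp add: algebra_simps)
qed (simp add: slope_zero)

lemma slope_uminus_ge: "x \<in> F_vecs \<Longrightarrow> x \<in> V \<Longrightarrow> v \<in> int_vecs \<Longrightarrow> 0 \<le> slope f x v + slope f x (- v)"
  using slope_add[of x v "- v"] slope_zero[of x] by (auto intro: int_vecs_uminus)

lemma slope_axis_le:
  assumes x: "x \<in> F_vecs" "x \<in> V" and v: "v = axis i 1 \<or> v = - axis i 1"
  shows "slope f x v \<le> M"
proof -
  have vi: "v \<in> int_vecs" using v by (auto intro: int_vecs_intros)
  have "\<forall>\<^sub>F t in at_right 0. t \<in> F \<longrightarrow> x + t *\<^sub>R v \<in> V"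
    using open_feasible[OF V_open x(2), of v] by eventually_elim simp
  then obtain t where t: "t \<in> F" "t > 0" "x + t *\<^sub>R v \<in> V" by (rule eventually_F_witness)
  have "f x + slope f x v * t \<le> f (x + t *\<^sub>R v)"
    using x t vi by (intro slope_below V_subset) auto
  also have "\<dots> \<le> f x + M * t" using x t v by (intro growth[where i = i] V_subset) auto
  finally show ?thesis using t(2) by simp
qed

lemma slope_along_line:
  assumes x: "x \<in> F_vecs" "x \<in> V" and uv: "u \<in> int_vecs" "v \<in> int_vecs"
  shows "\<forall>\<^sub>F t in at_right 0. t \<in> F \<longrightarrow> slope f (x + t *\<^sub>R u) v \<le> slope f x v"
proof -
  have "\<forall>\<^sub>F t in at_right 0. t \<in> F \<longrightarrow> x + t *\<^sub>R v \<in> V \<and> f (x + t *\<^sub>R v) = f x + slope f x v * t"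
    using open_feasible[OF V_open x(2), of v] slope_in_V(1)[OF x uv(2), unfolded has_slope_def]
    by eventually_elim simp
  then obtain \<tau> where \<tau>: "\<tau> \<in> F" "\<tau> > 0" "x + \<tau> *\<^sub>R v \<in> V" "f (x + \<tau> *\<^sub>R v) = f x + slope f x v * \<tau>"
    by (rule eventually_F_witness) auto
  let ?y = "x + \<tau> *\<^sub>R v"
  have y: "?y \<in> F_vecs" using x \<tau> uv by (intro F_vecs_shift)
  have "\<forall>\<^sub>F t in at_right 0. 0 + (slope f ?y u - slope f x u) * t < \<tau> + 0 * t"
    using \<tau>(2) by (rule eventually_affine_less)
  with open_feasible[OF V_open x(2), of u] open_feasible[OF V_open \<tau>(3), of u]
    slope_in_V(1)[OF x uv(1), unfolded has_slope_def] slope_in_V(1)[OF y \<tau>(3) uv(1), unfolded has_slope_def]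
  show ?thesis
  proof eventually_elim
    case (elim t)
    show ?case
    proof
      assume t: "t \<in> F"
      let ?x' = "x + t *\<^sub>R u"
      have x'F: "?x' \<in> F_vecs" using x t uv by (intro F_vecs_shift)
      have comm: "?x' + \<tau> *\<^sub>R v = ?y + t *\<^sub>R u" by simp
      have "f ?x' + slope f ?x' v * \<tau> \<le> f (?x' + \<tau> *\<^sub>R v)"
        using x'F elim \<tau> uv by (intro slope_below) (auto simp: add.commute add.left_commute intro: V_subset)
      also have "\<dots> = f x + slope f x v * \<tau> + slope f ?y u * t"
        unfolding comm using elim(4) t \<tau>(4) by simp
      finally have "slope f ?x' v * \<tau> \<le> slope f x v * \<tau> + (slope f ?y u - slope f x u) * t"
        using elim(3) t by (simp add: algebra_simps)
      also have "\<dots> < (slope f x v + 1) * \<tau>" using elim(5) by (simp add: algebra_simps)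
      finally have "slope f ?x' v < slope f x v + 1" using \<tau>(2) by simp
      moreover have "slope f ?x' v \<in> \<int>" "slope f x v \<in> \<int>"
        using slope_in_V(2) x'F elim(1) x uv by auto
      ultimately show "slope f ?x' v \<le> slope f x v" by (auto elim!: Ints_cases)
    qed
  qed
qed

definition smooth :: "real ^ 'n \<Rightarrow> bool" where
  "smooth x \<longleftrightarrow> x \<in> F_vecs \<and> x \<in> V \<and> (\<forall>i. slope f x (axis i 1) + slope f x (- axis i 1) = 0)"

text \<open>The defect \<open>\<sigma>\<close> is a nonnegative integer, and it drops when a point with positive defect in
  direction \<open>i\<close> is moved slightly along the \<open>i\<close>-th axis.\<close>

lemma smooth_dense:
  assumes "open W" "W \<noteq> {}" "W \<subseteq> V"
  obtains x where "smooth x" "x \<in> W"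
proof -
  define \<sigma> where "\<sigma> x = (\<Sum>i\<in>UNIV. slope f x (axis i 1) + slope f x (- axis i 1))" for x
  have \<sigma>: "\<sigma> x \<in> \<int>" "\<sigma> x \<ge> 0" if "x \<in> F_vecs" "x \<in> V" for x
    unfolding \<sigma>_def using slope_in_V(2)[OF that] slope_uminus_ge[OF that]
    by (auto intro!: Ints_add sum_nonneg int_vecs_axis int_vecs_uminus Ints_sum)
  obtain x0 where "x0 \<in> F_vecs" "x0 \<in> W" using F_vecs_dense[OF assms(1,2)] .
  then obtain x where x: "x \<in> F_vecs" "x \<in> W"
    and min: "\<And>y. y \<in> F_vecs \<Longrightarrow> y \<in> W \<Longrightarrow> nat \<lfloor>\<sigma> x\<rfloor> \<le> nat \<lfloor>\<sigma> y\<rfloor>"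
    using ex_has_least_nat[of "\<lambda>x. x \<in> F_vecs \<and> x \<in> W" x0 "\<lambda>x. nat \<lfloor>\<sigma> x\<rfloor>"] by blast
  have xV: "x \<in> V" using x assms by blast
  have "smooth x"
  proof (rule ccontr)
    assume "\<not> smooth x"
    then obtain i where "slope f x (axis i 1) + slope f x (- axis i 1) \<noteq> 0"
      using x xV by (auto simp: smooth_def)
    with slope_uminus_ge[OF x(1) xV int_vecs_axis[of i]]
    have i: "slope f x (axis i 1) + slope f x (- axis i 1) > 0" by linarith
    let ?u = "axis i 1 :: real ^ 'n"
    have ui: "?u \<in> int_vecs" by (rule int_vecs_axis)
    obtain \<delta> where \<delta>: "\<delta> > 0" "\<And>t. 0 < t \<Longrightarrow> t < \<delta> \<Longrightarrow> t \<in> F \<longrightarrow> f (x + t *\<^sub>R ?u) = f x + slope f x ?u * t"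
      using slope_in_V(1)[OF x(1) xV ui] unfolding has_slope_def eventually_at_right_field by auto
    have "\<forall>\<^sub>F t in at_right 0. t < \<delta>"
      using eventually_affine_less[OF \<delta>(1), of 1 0] by simp
    moreover have "\<forall>\<^sub>F t in at_right 0. \<forall>k\<in>UNIV. t \<in> F \<longrightarrow>
        slope f (x + t *\<^sub>R ?u) (axis k 1) \<le> slope f x (axis k 1)"
      by (intro eventually_ball_finite ballI slope_along_line[OF x(1) xV ui] int_vecs_axis) auto
    moreover have "\<forall>\<^sub>F t in at_right 0. \<forall>k\<in>UNIV. t \<in> F \<longrightarrow>
        slope f (x + t *\<^sub>R ?u) (- axis k 1) \<le> slope f x (- axis k 1)"
      by (intro eventually_ball_finite ballI slope_along_line[OF x(1) xV ui] int_vecs_uminus int_vecs_axis) auto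
    ultimately have "\<forall>\<^sub>F t in at_right 0. t \<in> F \<longrightarrow> x + t *\<^sub>R ?u \<in> W \<and> t < \<delta> \<and>
        (\<forall>k. slope f (x + t *\<^sub>R ?u) (axis k 1) \<le> slope f x (axis k 1) \<and>
             slope f (x + t *\<^sub>R ?u) (- axis k 1) \<le> slope f x (- axis k 1))"
      using open_feasible[OF assms(1) x(2), of ?u] by eventually_elim blast
    then obtain t where t: "t \<in> F" "t > 0" "x + t *\<^sub>R ?u \<in> W" "t < \<delta>"
        "\<And>k. slope f (x + t *\<^sub>R ?u) (axis k 1) \<le> slope f x (axis k 1)"
        "\<And>k. slope f (x + t *\<^sub>R ?u) (- axis k 1) \<le> slope f x (- axis k 1)"
      by (rule eventually_F_witness) auto
    let ?x' = "x + t *\<^sub>R ?u"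
    have x': "?x' \<in> F_vecs" "?x' \<in> V" using x t ui assms by (auto intro!: F_vecs_shift)
    have fx': "f ?x' = f x + slope f x ?u * t" using \<delta>(2) t by auto
    have "has_slope f ?x' ?u (slope f x ?u)"
      unfolding has_slope_def eventually_at_right_field
    proof (intro exI conjI allI impI)
      show "0 < \<delta> - t" using t by simp
      fix s assume "0 < s" "s < \<delta> - t" "s \<in> F"
      then have "f (x + (t + s) *\<^sub>R ?u) = f x + slope f x ?u * (t + s)"
        using \<delta>(2)[of "t + s"] t by (auto intro: F_add)
      then show "f (?x' + s *\<^sub>R ?u) = f ?x' + slope f x ?u * s"
        unfolding fx' by (simp add: algebra_simps)
    qed
    moreover have "has_slope f ?x' (- ?u) (- slope f x ?u)"
      unfolding has_slope_def eventually_at_right_field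
    proof (intro exI conjI allI impI)
      show "0 < t" by fact
      fix s assume "0 < s" "s < t" "s \<in> F"
      then have "f (x + (t - s) *\<^sub>R ?u) = f x + slope f x ?u * (t - s)"
        using \<delta>(2)[of "t - s"] t by (auto intro: F_diff)
      then show "f (?x' + s *\<^sub>R (- ?u)) = f ?x' + - slope f x ?u * s"
        unfolding fx' by (simp add: algebra_simps)
    qed
    ultimately have "slope f ?x' ?u + slope f ?x' (- ?u) = 0" by (simp add: slope_eqI)
    then have "\<sigma> ?x' < \<sigma> x"
      unfolding \<sigma>_def using i t(5,6) by (intro sum_strict_mono_ex1) (auto intro: add_mono intro!: exI[of _ i])
    moreover obtain m m' where "\<sigma> x = of_int m" "\<sigma> ?x' = of_int m'"
      using \<sigma>(1)[OF x(1) xV] \<sigma>(1)[OF x'] by (metis Ints_cases)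
    ultimately have "nat \<lfloor>\<sigma> ?x'\<rfloor> < nat \<lfloor>\<sigma> x\<rfloor>" using \<sigma>(2)[OF x'] by simp
    with min[OF x'(1) t(3)] show False by simp
  qed
  then show ?thesis using that x by blast
qed

definition gradient :: "real ^ 'n \<Rightarrow> real ^ 'n" where
  "gradient x = (\<chi> i. slope f x (axis i 1))"

lemma smooth_slope_ge:
  assumes "smooth x" "v \<in> int_vecs"
  shows "gradient x \<bullet> v \<le> slope f x v"
proof -
  have x: "x \<in> F_vecs" "x \<in> V" using assms by (auto simp: smooth_def)
  have axis: "slope f x (c *\<^sub>R axis i 1) \<le> c * slope f x (axis i 1)" if c: "c \<in> \<int>" for c i
  proof -
    obtain m where m: "c = of_int m" using c by (rule Ints_cases)
    show ?thesis
    proof (cases "m \<ge> 0")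
      case True
      then show ?thesis using slope_scale_le[OF x int_vecs_axis[of i], of "nat m"] m by simp
    next
      case False
      have "slope f x (- axis i 1) = - slope f x (axis i 1)"
        using assms(1) by (simp add: smooth_def eq_neg_iff_add_eq_0 add.commute)
      with False show ?thesis
        using slope_scale_le[OF x int_vecs_uminus[OF int_vecs_axis[of i]], of "nat (- m)"] m by simp
    qed
  qed
  have le: "slope f x w \<le> gradient x \<bullet> w" if w: "w \<in> int_vecs" for w
  proof -
    have ints: "w $ i *\<^sub>R axis i 1 \<in> int_vecs" for i :: 'n
      using w by (intro int_vecs_scaleR int_vecs_axis) (auto simp: rational_points_def)
    have "slope f x (\<Sum>i\<in>A. w $ i *\<^sub>R axis i 1) \<le> (\<Sum>i\<in>A. w $ i * slope f x (axis i 1)) \<and>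
        (\<Sum>i\<in>A. w $ i *\<^sub>R axis i 1) \<in> int_vecs" if "finite A" for A
      using that
    proof (induction A rule: finite_induct)
      case (insert i A)
      have "slope f x (w $ i *\<^sub>R axis i 1) \<le> w $ i * slope f x (axis i 1)"
        using w by (intro axis) (auto simp: rational_points_def)
      moreover have "slope f x (w $ i *\<^sub>R axis i 1 + (\<Sum>i\<in>A. w $ i *\<^sub>R axis i 1))
          \<le> slope f x (w $ i *\<^sub>R axis i 1) + slope f x (\<Sum>i\<in>A. w $ i *\<^sub>R axis i 1)"
        using insert.IH ints by (intro slope_add x) auto
      ultimately show ?case using insert ints by (auto intro: int_vecs_add)
    qed (auto simp: slope_zero int_vecs_zero)
    from this[of UNIV] have "slope f x (\<Sum>i\<in>UNIV. w $ i *\<^sub>R axis i 1) \<le> gradient x \<bullet> w"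
      by (simp add: gradient_def inner_vec_def mult.commute)
    moreover have "(\<Sum>i\<in>UNIV. w $ i *\<^sub>R axis i 1) = w"
      using basis_expansion[of w] by (simp add: scalar_mult_eq_scaleR)
    ultimately show ?thesis by simp
  qed
  have "0 \<le> slope f x v + slope f x (- v)" using x assms(2) by (rule slope_uminus_ge)
  with le[OF int_vecs_uminus[OF assms(2)]] show ?thesis by simp
qed

lemma smooth_support:
  assumes x: "smooth x" and y: "y \<in> F_vecs" "y \<in> V"
  shows "f x + gradient x \<bullet> (y - x) \<le> f y"
proof (rule ccontr)
  assume neg: "\<not> ?thesis"
  define gap where "gap = f x + gradient x \<bullet> (y - x) - f y"
  have gap: "gap > 0" using neg by (simp add: gap_def)
  have xV: "x \<in> F_vecs" "x \<in> V" using x by (auto simp: smooth_def)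
  obtain e where e: "e > 0" "ball y e \<subseteq> V" using V_open y(2) open_contains_ball by blast
  define L where "L = M * real CARD('n) + norm (gradient x) + 1"
  have L: "L > 0" unfolding L_def using M_nonneg by (intro add_nonneg_pos add_nonneg_nonneg) auto
  define r where "r = min e (gap / L)"
  have r: "r > 0" using e gap L by (simp add: r_def)
  obtain w N where w: "w \<in> int_vecs" "N > (0 :: nat)" "x + (1 / real N) *\<^sub>R w \<in> ball y r"
    using rational_translate_dense[OF open_ball, of y r x] r by (metis centre_in_ball empty_iff)
  let ?y = "x + (1 / real N) *\<^sub>R w"
  have NF: "1 / real N \<in> F" by (intro F_intros) auto
  have y': "?y \<in> F_vecs" using xV w NF by (intro F_vecs_shift)
  have yV: "?y \<in> V" "?y \<in> ball y e" using w e by (auto simp: r_def)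
  have "f x + slope f x w * (1 / real N) \<le> f ?y"
    using xV w(1) NF V_subset[OF yV(1)] by (intro slope_below) auto
  moreover have "gradient x \<bullet> w * (1 / real N) \<le> slope f x w * (1 / real N)"
    using smooth_slope_ge[OF x w(1)] by (intro mult_right_mono) auto
  ultimately have "f x + gradient x \<bullet> (?y - x) \<le> f ?y" by simp
  moreover have "\<bar>f ?y - f y\<bar> \<le> M * real CARD('n) * norm (?y - y)"
    using y(1) e(2) y' yV(2) by (rule lipschitz_near_norm)
  moreover have "gradient x \<bullet> (y - x) - gradient x \<bullet> (?y - x) \<le> norm (gradient x) * norm (?y - y)"
  proof -
    have "gradient x \<bullet> (y - x) - gradient x \<bullet> (?y - x) = gradient x \<bullet> (y - ?y)"
      by (simp add: inner_diff_right inner_add_right)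
    also have "\<dots> \<le> norm (gradient x) * norm (y - ?y)" by (rule norm_cauchy_schwarz)
    finally show ?thesis by (simp only: norm_minus_commute)
  qed
  ultimately have "gap \<le> (M * real CARD('n) + norm (gradient x)) * norm (?y - y)"
    unfolding gap_def distrib_right by linarith
  also have "\<dots> \<le> L * norm (?y - y)" unfolding L_def by (intro mult_right_mono) auto
  also have "\<dots> < gap"
    using w(3) L by (auto simp: r_def dist_norm norm_minus_commute field_simps)
  finally show False by simp
qed

lemma gradient_bounds:
  assumes "smooth x"
  shows "gradient x \<in> int_vecs" "\<bar>gradient x $ i\<bar> \<le> M"
proof -
  have x: "x \<in> F_vecs" "x \<in> V" using assms by (auto simp: smooth_def)
  show "gradient x \<in> int_vecs"
    using slope_in_V(2)[OF x int_vecs_axis] by (auto simp: gradient_def rational_points_def)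
  have "slope f x (- axis i 1) = - slope f x (axis i 1)"
    using assms by (simp add: smooth_def eq_neg_iff_add_eq_0 add.commute)
  then show "\<bar>gradient x $ i\<bar> \<le> M"
    using slope_axis_le[OF x, of "axis i 1" i] slope_axis_le[OF x, of "- axis i 1" i]
    by (auto simp: gradient_def)
qed

lemma finite_bounded_int_vecs: "finite {a :: real ^ 'n. a \<in> int_vecs \<and> (\<forall>i. \<bar>a $ i\<bar> \<le> M)}"
proof -
  define T where "T = real_of_int ` {- \<lfloor>M\<rfloor> .. \<lfloor>M\<rfloor>}"
  have "{a :: real ^ 'n. a \<in> int_vecs \<and> (\<forall>i. \<bar>a $ i\<bar> \<le> M)} \<subseteq> (\<lambda>g. \<chi> i. g i) ` (PiE UNIV (\<lambda>_. T))"
  proof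
    fix a :: "real ^ 'n" assume a: "a \<in> {a. a \<in> int_vecs \<and> (\<forall>i. \<bar>a $ i\<bar> \<le> M)}"
    have "a $ i \<in> T" for i
    proof -
      have "a $ i \<in> \<int>" using a by (simp add: rational_points_def)
      then obtain m where m: "a $ i = of_int m" by (rule Ints_cases)
      have "\<bar>a $ i\<bar> \<le> M" using a by simp
      then have "m \<le> \<lfloor>M\<rfloor>" "- m \<le> \<lfloor>M\<rfloor>" unfolding m le_floor_iff by auto
      then show ?thesis unfolding T_def m by auto
    qed
    then show "a \<in> (\<lambda>g. \<chi> i. g i) ` (PiE UNIV (\<lambda>_. T))"
      by (intro image_eqI[of _ _ "\<lambda>i. a $ i"]) auto
  qed
  moreover have "finite (PiE (UNIV :: 'n set) (\<lambda>_. T))" by (intro finite_PiE) (auto simp: T_def)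
  ultimately show ?thesis by (meson finite_imageI finite_subset)
qed

definition supports :: "((real ^ 'n) \<times> real) set" where
  "supports = (\<lambda>x. (gradient x, f x - gradient x \<bullet> x)) ` {x. smooth x}"

lemma supports_le: "(a, b) \<in> supports \<Longrightarrow> y \<in> F_vecs \<Longrightarrow> y \<in> V \<Longrightarrow> a \<bullet> y + b \<le> f y"
  unfolding supports_def using smooth_support by (fastforce simp: inner_diff_right)

lemma integral_system_supports: "integral_system supports"
proof -
  have "inj_on fst supports"
  proof (rule inj_onI)
    fix p q assume "p \<in> supports" "q \<in> supports" and eq: "fst p = fst q"
    then obtain x y where xy: "smooth x" "p = (gradient x, f x - gradient x \<bullet> x)"
      "smooth y" "q = (gradient y, f y - gradient y \<bullet> y)" by (auto simp: supports_def)
    then have "x \<in> F_vecs" "x \<in> V" "y \<in> F_vecs" "y \<in> V" by (auto simp: smooth_def)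
    with smooth_support[OF xy(1), of y] smooth_support[OF xy(3), of x] eq xy(2,4) show "p = q"
      by (auto simp: inner_diff_right)
  qed
  moreover have "finite (fst ` supports)"
    by (rule finite_subset[OF _ finite_bounded_int_vecs]) (auto simp: supports_def gradient_bounds)
  ultimately have "finite supports" by (rule finite_imageD[rotated])
  moreover have "supports \<subseteq> int_vecs \<times> F"
  proof -
    have "(gradient x, f x - gradient x \<bullet> x) \<in> int_vecs \<times> F" if "smooth x" for x
    proof -
      have "x \<in> F_vecs" "x \<in> V" using that by (auto simp: smooth_def)
      then show ?thesis using gradient_bounds(1)[OF that] line_polyhedral_value_in_F[OF lines] V_subset
        by (auto intro!: F_diff F_inner intro: int_vecs_subset)
    qed
    then show ?thesis unfolding supports_def by blast
  qed
  ultimately show ?thesis by (simp add: integral_system_def)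
qed

lemma supports_nonempty: "supports \<noteq> {}"
proof -
  obtain x where "smooth x" using smooth_dense[OF V_open nonempty] by blast
  then show ?thesis by (auto simp: supports_def)
qed

lemma finite_supports: "finite supports"
  using integral_system_supports by (simp add: integral_system_def)

lemma supports_interior:
  assumes y: "y \<in> F_vecs" "y \<in> V"
  shows "max_affine supports y = f y"
proof (rule ccontr)
  assume "max_affine supports y \<noteq> f y"
  moreover obtain a b where "(a, b) \<in> supports" "max_affine supports y = a \<bullet> y + b"
    using max_affine_attained[OF finite_supports supports_nonempty] .
  ultimately have gap: "f y - max_affine supports y > 0" (is "?gap > 0") using supports_le y by fastforce
  obtain e where e: "e > 0" "ball y e \<subseteq> V" using V_open y(2) open_contains_ball by blast
  define L where "L = 2 * M * real CARD('n) + 1"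
  have L: "L > 0" unfolding L_def using M_nonneg by (intro add_nonneg_pos) auto
  define r where "r = min e (?gap / L)"
  have r: "r > 0" using e gap L by (simp add: r_def)
  have "ball y r \<noteq> {}" "ball y r \<subseteq> V" using r e by (auto simp: r_def)
  then obtain x where x: "smooth x" "x \<in> ball y r" using smooth_dense[OF open_ball] by blast
  have xF: "x \<in> F_vecs" "x \<in> V" using x by (auto simp: smooth_def)
  have "\<bar>f x - f y\<bar> \<le> M * real CARD('n) * norm (x - y)"
    using y(1) e(2) xF(1) by (rule lipschitz_near_norm) (use x in \<open>auto simp: r_def\<close>)
  moreover have "f x + gradient x \<bullet> (y - x) \<le> max_affine supports y"
    using max_affine_ge[OF finite_supports, of "gradient x" "f x - gradient x \<bullet> x" y] x
    by (auto simp: supports_def inner_diff_right algebra_simps)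
  moreover have "- (gradient x \<bullet> (y - x)) \<le> M * real CARD('n) * norm (x - y)"
  proof -
    have "norm (gradient x) \<le> (\<Sum>i\<in>(UNIV::'n set). M)"
      using gradient_bounds(2)[OF x(1)] by (intro order.trans[OF norm_le_l1_cart] sum_mono) auto
    then have "norm (gradient x) * norm (x - y) \<le> M * real CARD('n) * norm (x - y)"
      by (intro mult_right_mono) (auto simp: mult.commute)
    moreover have "- (gradient x \<bullet> (y - x)) = gradient x \<bullet> (x - y)" by (simp add: inner_diff_right)
    ultimately show ?thesis using norm_cauchy_schwarz[of "gradient x" "x - y"] by simp
  qed
  ultimately have "?gap \<le> 2 * M * real CARD('n) * norm (x - y)" by linarith
  also have "\<dots> \<le> L * norm (x - y)" unfolding L_def by (intro mult_right_mono) auto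
  also have "\<dots> < ?gap" using x(2) L by (auto simp: r_def dist_norm norm_minus_commute field_simps)
  finally show False by simp
qed

lemma supports_closure:
  assumes y: "y \<in> F_vecs" "y \<in> halfspaces_inter I"
  shows "max_affine supports y = f y"
proof -
  obtain w N where w: "w \<in> int_vecs" "N > (0 :: nat)" "y + (1 / real N) *\<^sub>R w \<in> V"
    using rational_translate_dense[OF V_open nonempty] by metis
  have in_V: "\<forall>\<^sub>F t in at_right 0. y + t *\<^sub>R w \<in> V"
    unfolding eventually_at_right_field
  proof (intro exI conjI allI impI)
    show "0 < 1 / real N" using w by simp
    fix t assume t: "0 < t" "t < 1 / real N"
    have "(1 - t * real N) *\<^sub>R y + (t * real N) *\<^sub>R (y + (1 / real N) *\<^sub>R w) \<in> V"
      using y(2) w t by (intro halfspaces_inter_segment) (auto simp: field_simps)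
    moreover have "(1 - t * real N) *\<^sub>R y + (t * real N) *\<^sub>R (y + (1 / real N) *\<^sub>R w) = y + t *\<^sub>R w"
      using w(2) by (simp add: algebra_simps)
    ultimately show "y + t *\<^sub>R w \<in> V" by simp
  qed
  define c where "c = slope f y w"
  have "\<forall>\<^sub>F t in at_right 0. y + t *\<^sub>R w \<in> halfspaces_inter I"
    using in_V by eventually_elim (rule V_subset)
  then have "has_slope f y w c" unfolding c_def by (intro line_polyhedral_has_slope[OF lines] y w)
  with in_V have ev: "\<forall>\<^sub>F t in at_right 0. t \<in> F \<longrightarrow> y + t *\<^sub>R w \<in> V \<and> f (y + t *\<^sub>R w) = f y + c * t"
    unfolding has_slope_def by eventually_elim simp
  have tF: "y + t *\<^sub>R w \<in> F_vecs" if "t \<in> F" for t using y w that by (intro F_vecs_shift)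
  have le: "a \<bullet> y + b \<le> f y" if ab: "(a, b) \<in> supports" for a b
  proof (rule ccontr)
    assume "\<not> ?thesis"
    then have "\<forall>\<^sub>F t in at_right 0. f y + c * t < a \<bullet> y + b + (a \<bullet> w) * t"
      by (intro eventually_affine_less) simp
    with ev have "\<forall>\<^sub>F t in at_right 0. t \<in> F \<longrightarrow> y + t *\<^sub>R w \<in> V \<and> f (y + t *\<^sub>R w) < a \<bullet> (y + t *\<^sub>R w) + b"
      by eventually_elim (auto simp: inner_add_right mult.commute)
    then obtain t where "t \<in> F" "y + t *\<^sub>R w \<in> V" "f (y + t *\<^sub>R w) < a \<bullet> (y + t *\<^sub>R w) + b"
      by (rule eventually_F_witness) auto
    with supports_le[OF ab tF] show False by fastforce
  qed
  have "\<exists>(a, b)\<in>supports. f y \<le> a \<bullet> y + b"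
  proof (rule ccontr)
    assume neg: "\<not> ?thesis"
    have "\<forall>\<^sub>F t in at_right 0. \<forall>p\<in>supports. fst p \<bullet> y + snd p + (fst p \<bullet> w) * t < f y + c * t"
      using neg by (intro eventually_ball_finite finite_supports ballI eventually_affine_less) force
    with ev have "\<forall>\<^sub>F t in at_right 0. t \<in> F \<longrightarrow> y + t *\<^sub>R w \<in> V \<and>
        (\<forall>p\<in>supports. fst p \<bullet> (y + t *\<^sub>R w) + snd p < f (y + t *\<^sub>R w))"
      by eventually_elim (auto simp: inner_add_right algebra_simps)
    then obtain t where t: "t \<in> F" "y + t *\<^sub>R w \<in> V"
        "\<And>p. p \<in> supports \<Longrightarrow> fst p \<bullet> (y + t *\<^sub>R w) + snd p < f (y + t *\<^sub>R w)"
      by (rule eventually_F_witness) auto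
    obtain a b where "(a, b) \<in> supports" "max_affine supports (y + t *\<^sub>R w) = a \<bullet> (y + t *\<^sub>R w) + b"
      using max_affine_attained[OF finite_supports supports_nonempty] .
    with t(3)[of "(a, b)"] supports_interior[OF tF[OF t(1)] t(2)] show False by simp
  qed
  then show ?thesis using max_affine_eqI[OF finite_supports le] by blast
qed

end

context subfield_of_reals
begin

lemma facet_polyhedral:
  fixes f :: "real ^ 'n \<Rightarrow> real"
  assumes I: "integral_system I" and f: "line_polyhedral (halfspaces_inter I) f" and ab: "(a, b) \<in> I"
    and IH: "\<And>J (g :: real ^ 'n \<Rightarrow> real). card J < card I \<Longrightarrow> integral_system J \<Longrightarrow>
      line_polyhedral (halfspaces_inter J) g \<Longrightarrow> \<exists>K. integral_system K \<and> K \<noteq> {} \<and>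
        (\<forall>x\<in>F_vecs. x \<in> halfspaces_inter J \<longrightarrow> g x = max_affine K x)"
  shows "\<exists>K. integral_system K \<and> K \<noteq> {} \<and>
    (\<forall>x\<in>F_vecs. x \<in> halfspaces_inter I \<longrightarrow> a \<bullet> x + b = 0 \<longrightarrow> f x = max_affine K x)"
proof (cases "\<exists>z. a \<bullet> z + b = 0")
  case False
  then show ?thesis
    by (intro exI[of _ "{(0, 0)}"]) (auto simp: integral_system_def int_vecs_zero)
next
  case True
  then obtain z where "a \<bullet> z + b = 0" by blast
  from project_out[OF I ab this] obtain A d J where
    A: "linear A" "\<And>v. v \<in> int_vecs \<Longrightarrow> A v \<in> int_vecs"
    "\<And>x. x \<in> F_vecs \<Longrightarrow> A x + d \<in> F_vecs" "integral_system J" "card J < card I"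
    "\<And>x. A x + d \<in> halfspaces_inter I \<longleftrightarrow> x \<in> halfspaces_inter J"
    "\<And>x. a \<bullet> x + b = 0 \<Longrightarrow> A x + d = x" by blast
  let ?h = "\<lambda>x. A x + d"
  have shift: "?h (x + t *\<^sub>R v) = ?h x + t *\<^sub>R A v" for x t v
    using A(1) by (simp add: linear_add linear_scale)
  have "line_polyhedral (halfspaces_inter J) (\<lambda>x. f (?h x))"
    unfolding line_polyhedral_def
  proof (intro ballI)
    fix x v :: "real ^ 'n" assume "x \<in> F_vecs" "v \<in> int_vecs"
    then have "?h x \<in> F_vecs" "A v \<in> int_vecs" using A by auto
    with f show "\<exists>\<Gamma>. finite \<Gamma> \<and> \<Gamma> \<noteq> {} \<and> \<Gamma> \<subseteq> \<int> \<times> F \<and>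
        (\<forall>t\<in>F. x + t *\<^sub>R v \<in> halfspaces_inter J \<longrightarrow> f (?h (x + t *\<^sub>R v)) = Max ((\<lambda>(c, d). c * t + d) ` \<Gamma>))"
      unfolding line_polyhedral_def A(6)[symmetric] shift by blast
  qed
  from IH[OF A(5,4) this] obtain K where K: "integral_system K" "K \<noteq> {}"
    "\<And>x. x \<in> F_vecs \<Longrightarrow> x \<in> halfspaces_inter J \<Longrightarrow> f (?h x) = max_affine K x" by blast
  have "f x = max_affine K x" if "x \<in> F_vecs" "x \<in> halfspaces_inter I" "a \<bullet> x + b = 0" for x
    using K(3)[OF that(1)] A(6)[of x] A(7)[OF that(3)] that(2) by simp
  with K show ?thesis by blast
qed

lemma line_polyhedral_imp_max_affine:
  fixes f :: "real ^ 'n \<Rightarrow> real"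
  assumes "integral_system I" "line_polyhedral (halfspaces_inter I) f"
  shows "\<exists>K. integral_system K \<and> K \<noteq> {} \<and>
    (\<forall>x\<in>F_vecs. x \<in> halfspaces_inter I \<longrightarrow> f x = max_affine K x)"
  using assms
proof (induction "card I" arbitrary: I f rule: less_induct)
  case less
  note facets = facet_polyhedral[OF less.prems _ less.hyps]
  have finI: "finite I" using less.prems by (simp add: integral_system_def)
  consider "halfspaces_inter I = {}" | "open_halfspaces_inter I = {}" "halfspaces_inter I \<noteq> {}"
    | "open_halfspaces_inter I \<noteq> {}" by blast
  then show ?case
  proof cases
    case 1
    then show ?thesis
      by (intro exI[of _ "{(0, 0)}"]) (auto simp: integral_system_def int_vecs_zero)
  next
    case 2
    then obtain a b where ab: "(a, b) \<in> I" and eq: "\<And>x. x \<in> halfspaces_inter I \<Longrightarrow> a \<bullet> x + b = 0"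
      using implicit_equality[OF finI convex_UNIV] by auto
    from facets[OF ab] eq show ?thesis by blast
  next
    case 3
    have "\<forall>v\<in>int_vecs. \<exists>M. \<forall>x \<in> F_vecs \<inter> open_halfspaces_inter I. \<forall>t\<in>F. 0 \<le> t \<longrightarrow>
        x + t *\<^sub>R v \<in> halfspaces_inter I \<longrightarrow> f (x + t *\<^sub>R v) \<le> f x + M * t"
      by (intro ballI growth_bound[OF less.prems] facets)
    then obtain B where B: "\<And>v x t. v \<in> int_vecs \<Longrightarrow> x \<in> F_vecs \<Longrightarrow> x \<in> open_halfspaces_inter I \<Longrightarrow>
        t \<in> F \<Longrightarrow> 0 \<le> t \<Longrightarrow> x + t *\<^sub>R v \<in> halfspaces_inter I \<Longrightarrow> f (x + t *\<^sub>R v) \<le> f x + B v * t"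
      unfolding bchoice_iff by blast
    define E :: "(real ^ 'n) set" where "E = range (\<lambda>i. axis i 1) \<union> range (\<lambda>i. - axis i 1)"
    have E: "finite E" "E \<subseteq> int_vecs" unfolding E_def by (auto intro: int_vecs_intros)
    define M where "M = Max (insert 0 (B ` E))"
    have M: "0 \<le> M" "\<And>v. v \<in> E \<Longrightarrow> B v \<le> M" unfolding M_def using E by (auto intro: Max_ge)
    interpret bounded_growth F I f M
    proof unfold_locales
      fix x v :: "real ^ 'n" and t i
      assume *: "x \<in> F_vecs" "x \<in> open_halfspaces_inter I" "t \<in> F" "0 \<le> t"
        "v = axis i 1 \<or> v = - axis i 1" "x + t *\<^sub>R v \<in> halfspaces_inter I"
      then have v: "v \<in> E" by (auto simp: E_def)
      then have "f (x + t *\<^sub>R v) \<le> f x + B v * t" using * E by (intro B) auto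
      also have "\<dots> \<le> f x + M * t" using M(2)[OF v] * by (intro add_left_mono mult_right_mono)
      finally show "f (x + t *\<^sub>R v) \<le> f x + M * t" .
    qed (use less.prems 3 M in auto)
    show ?thesis using supports_closure integral_system_supports supports_nonempty by metis
  qed
qed

lemma F_rational_line_through:
  fixes x v :: "real ^ 'n"
  assumes x: "x \<in> F_vecs" and v: "v \<in> int_vecs" "v \<noteq> 0"
  shows "F_rational_line F (range (\<lambda>t. x + t *\<^sub>R v))" (is "F_rational_line F ?L")
proof -
  have L: "?L = affine hull {x, x + v}"
  proof -
    have "(\<exists>t. y = x + t *\<^sub>R v) \<longleftrightarrow> (\<exists>s t. y = s *\<^sub>R x + t *\<^sub>R (x + v) \<and> s + t = 1)" for y
    proof
      assume "\<exists>t. y = x + t *\<^sub>R v"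
      then obtain t where "y = x + t *\<^sub>R v" ..
      then have "y = (1 - t) *\<^sub>R x + t *\<^sub>R (x + v) \<and> (1 - t) + t = 1" by (simp add: algebra_simps)
      then show "\<exists>s t. y = s *\<^sub>R x + t *\<^sub>R (x + v) \<and> s + t = 1" by blast
    next
      assume "\<exists>s t. y = s *\<^sub>R x + t *\<^sub>R (x + v) \<and> s + t = 1"
      then obtain s t where y: "y = s *\<^sub>R x + t *\<^sub>R (x + v)" and st: "s + t = 1" by blast
      have "y = (s + t) *\<^sub>R x + t *\<^sub>R v" unfolding y by (simp add: algebra_simps)
      with st show "\<exists>t. y = x + t *\<^sub>R v" by auto
    qed
    then show ?thesis unfolding affine_hull_2 by blast
  qed
  obtain k where k: "v $ k \<noteq> 0" using v(2) by (auto simp: vec_eq_iff)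
  define c where "c i = v $ k *\<^sub>R axis i 1 - v $ i *\<^sub>R axis k (1 :: real)" for i
  have c_int: "c i \<in> int_vecs" "- c i \<in> int_vecs" for i
    unfolding c_def using v(1) by (auto simp: rational_points_def axis_def)
  have c_nz: "c i \<noteq> 0" if "i \<noteq> k" for i
    using that k by (auto simp: c_def vec_eq_iff axis_def intro!: exI[of _ i])
  define H where "H = (\<lambda>i. {y. c i \<bullet> y + - (c i \<bullet> x) \<ge> 0}) ` (- {k}) \<union>
    (\<lambda>i. {y. - c i \<bullet> y + c i \<bullet> x \<ge> 0}) ` (- {k})"
  have halfspaceI: "F_rational_halfspace F {y. a \<bullet> y + b \<ge> 0}" if "a \<in> int_vecs" "a \<noteq> 0" "b \<in> F"
    for a :: "real ^ 'n" and b
    using that unfolding F_rational_halfspace_def rational_points_def by blast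
  have cx: "c i \<bullet> x \<in> F" "- (c i \<bullet> x) \<in> F" for i
    using F_inner[OF int_vecs_subset[OF c_int(1)] x] F_uminus by auto
  have "F_rational_halfspace F h" if "h \<in> H" for h
  proof -
    from that consider i where "i \<noteq> k" "h = {y. c i \<bullet> y + - (c i \<bullet> x) \<ge> 0}"
      | i where "i \<noteq> k" "h = {y. - c i \<bullet> y + c i \<bullet> x \<ge> 0}"
      unfolding H_def by blast
    then show ?thesis
    proof cases
      case 1
      show ?thesis unfolding 1(2) by (rule halfspaceI[OF c_int(1) c_nz[OF 1(1)] cx(2)])
    next
      case 2
      have "- c i \<noteq> 0" using c_nz[OF 2(1)] by simp
      then show ?thesis unfolding 2(2) by (rule halfspaceI[OF c_int(2) _ cx(1)])
    qed
  qed
  moreover have "?L = \<Inter>H"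
  proof -
    have "y \<in> \<Inter>H \<longleftrightarrow> (\<forall>i. i \<noteq> k \<longrightarrow> c i \<bullet> (y - x) = 0)" for y
    proof -
      have "y \<in> \<Inter>H \<longleftrightarrow> (\<forall>i\<in>- {k}. c i \<bullet> y + - (c i \<bullet> x) \<ge> 0) \<and> (\<forall>i\<in>- {k}. - c i \<bullet> y + c i \<bullet> x \<ge> 0)"
        by (simp add: H_def Inter_Un_distrib)
      also have "\<dots> \<longleftrightarrow> (\<forall>i. i \<noteq> k \<longrightarrow> c i \<bullet> (y - x) = 0)"
        by (auto simp: inner_diff_right intro: order.antisym)
      finally show ?thesis .
    qed
    moreover have "c i \<bullet> w = v $ k * w $ i - v $ i * w $ k" for i w
      by (simp add: c_def inner_diff_left inner_axis')
    ultimately have H: "y \<in> \<Inter>H \<longleftrightarrow> (\<forall>i. i \<noteq> k \<longrightarrow> v $ k * (y - x) $ i = v $ i * (y - x) $ k)" for y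
      by auto
    have "y \<in> ?L" if "y \<in> \<Inter>H" for y
    proof -
      have "y = x + ((y - x) $ k / v $ k) *\<^sub>R v"
        unfolding vec_eq_iff
      proof
        fix i
        have "v $ k * (y - x) $ i = v $ i * (y - x) $ k" using H that by (cases "i = k") auto
        then show "y $ i = (x + ((y - x) $ k / v $ k) *\<^sub>R v) $ i" using k by (simp add: field_simps)
      qed
      then show ?thesis by blast
    qed
    moreover have "y \<in> \<Inter>H" if "y \<in> ?L" for y
      using that H by auto
    ultimately show ?thesis by blast
  qed
  ultimately have "F_rational_polyhedral F ?L"
    unfolding F_rational_polyhedral_def by (intro exI[of _ H]) (auto simp: H_def)
  moreover have "aff_dim ?L = 1" using v(2) by (simp add: L aff_dim_2)
  moreover have "affine ?L" by (simp add: L)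
  ultimately show ?thesis unfolding F_rational_line_def by blast
qed

lemma F_integral_affine_along_line:
  assumes "F_integral_affine F l" "x \<in> F_vecs" "v \<in> int_vecs"
  shows "l (x + t *\<^sub>R v) = (l (x + v) - l x) * t + l x" "l (x + v) - l x \<in> \<int>" "l x \<in> F"
proof -
  obtain a b where ab: "a \<in> int_vecs" "b \<in> F" "l = (\<lambda>x. a \<bullet> x + b)"
    using assms(1) unfolding F_integral_affine_def rational_points_def by blast
  show "l (x + t *\<^sub>R v) = (l (x + v) - l x) * t + l x"
    unfolding ab(3) by (simp add: inner_add_right mult.commute)
  show "l (x + v) - l x \<in> \<int>"
    unfolding ab(3) using int_vecs_inner[OF ab(1) assms(3)] by (simp add: inner_add_right)
  show "l x \<in> F"
    unfolding ab(3) using ab assms(2) by (simp add: F_add F_inner int_vecs_subset)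
qed

lemma F_integral_polyhedral_on_lines:
  fixes f :: "real ^ 'n \<Rightarrow> real"
  assumes "\<And>L. F_rational_line F L \<Longrightarrow> F_integral_polyhedral_on F (S \<inter> F_vecs \<inter> L) f"
  shows "line_polyhedral S f"
  unfolding line_polyhedral_def
proof (intro ballI)
  fix x v :: "real ^ 'n" assume x: "x \<in> F_vecs" and v: "v \<in> int_vecs"
  have nontrivial: "\<exists>\<Gamma>. finite \<Gamma> \<and> \<Gamma> \<noteq> {} \<and> \<Gamma> \<subseteq> \<int> \<times> F \<and>
     (\<forall>t\<in>F. x + t *\<^sub>R w \<in> S \<longrightarrow> f (x + t *\<^sub>R w) = Max ((\<lambda>(c, d). c * t + d) ` \<Gamma>))"
    if w: "w \<in> int_vecs" "w \<noteq> 0" for w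
  proof -
    obtain \<Lambda> where \<Lambda>: "finite \<Lambda>" "\<Lambda> \<noteq> {}" "\<And>l. l \<in> \<Lambda> \<Longrightarrow> F_integral_affine F l"
      "\<And>y. y \<in> S \<inter> F_vecs \<inter> range (\<lambda>t. x + t *\<^sub>R w) \<Longrightarrow> f y = Max ((\<lambda>l. l y) ` \<Lambda>)"
      using assms[OF F_rational_line_through[OF x w]] unfolding F_integral_polyhedral_on_def by blast
    note aff = F_integral_affine_along_line[OF \<Lambda>(3) x w(1)]
    let ?\<Gamma> = "(\<lambda>l. (l (x + w) - l x, l x)) ` \<Lambda>"
    have "f (x + t *\<^sub>R w) = Max ((\<lambda>(c, d). c * t + d) ` ?\<Gamma>)" if "t \<in> F" "x + t *\<^sub>R w \<in> S" for t
    proof -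
      have "f (x + t *\<^sub>R w) = Max ((\<lambda>l. l (x + t *\<^sub>R w)) ` \<Lambda>)"
        using that F_vecs_shift[OF x that(1) w(1)] by (intro \<Lambda>(4)) blast
      also have "(\<lambda>l. l (x + t *\<^sub>R w)) ` \<Lambda> = (\<lambda>(c, d). c * t + d) ` ?\<Gamma>"
        unfolding image_image using aff(1) by (intro image_cong) auto
      finally show ?thesis .
    qed
    moreover have "?\<Gamma> \<subseteq> \<int> \<times> F" using aff(2,3) by (intro image_subsetI SigmaI)
    ultimately show ?thesis using \<Lambda>(1,2) by (intro exI[of _ ?\<Gamma>] conjI ballI impI) simp_all
  qed
  show "\<exists>\<Gamma>. finite \<Gamma> \<and> \<Gamma> \<noteq> {} \<and> \<Gamma> \<subseteq> \<int> \<times> F \<and>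
     (\<forall>t\<in>F. x + t *\<^sub>R v \<in> S \<longrightarrow> f (x + t *\<^sub>R v) = Max ((\<lambda>(c, d). c * t + d) ` \<Gamma>))"
  proof (cases "v = 0")
    case True
    obtain k :: 'n where True by blast
    obtain \<Gamma> where \<Gamma>: "finite \<Gamma>" "\<Gamma> \<noteq> {}" "\<Gamma> \<subseteq> \<int> \<times> F"
      "\<And>t. t \<in> F \<Longrightarrow> x + t *\<^sub>R axis k 1 \<in> S \<Longrightarrow> f (x + t *\<^sub>R axis k 1) = Max ((\<lambda>(c, d). c * t + d) ` \<Gamma>)"
      using nontrivial[OF int_vecs_axis[of k]] axis_eq_0_iff[of k "1 :: real"] by (metis zero_neq_one)
    let ?\<Gamma> = "(\<lambda>(c, d). (0, d)) ` \<Gamma>"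
    have "f x = Max ((\<lambda>(c, d). c * t + d) ` ?\<Gamma>)" if "x \<in> S" for t
      using \<Gamma>(4)[of 0] that by (simp add: image_image case_prod_beta)
    then show ?thesis using True \<Gamma>(1-3) by (intro exI[of _ ?\<Gamma>]) auto
  qed (use nontrivial v in blast)
qed

end

lemma F_rational_polyhedral_halfspaces_inter:
  assumes "F_rational_polyhedral F S"
  obtains I where "finite I" "I \<subseteq> int_vecs \<times> F" "S = halfspaces_inter I"
proof -
  obtain H where H: "finite H" "\<And>h. h \<in> H \<Longrightarrow> F_rational_halfspace F h" "S = \<Inter>H"
    using assms unfolding F_rational_polyhedral_def by blast
  let ?h = "\<lambda>(a, b). {x. a \<bullet> x + b \<ge> 0}"
  have "H \<subseteq> ?h ` (int_vecs \<times> F)"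
    using H(2) unfolding F_rational_halfspace_def rational_points_def by force
  then obtain I where "I \<subseteq> int_vecs \<times> F" "finite I" "H = ?h ` I"
    using finite_subset_image[OF H(1)] by metis
  moreover from this have "S = halfspaces_inter I"
    unfolding H(3) halfspaces_inter_def by auto
  ultimately show ?thesis using that by blast
qed

theorem theorem7p4:
  fixes F :: "real set" and S :: "(real ^ 'n) set" and f :: "real ^ 'n \<Rightarrow> real"
  assumes "real_subfield F"
    and "F_rational_polyhedral F S"
    and "\<And>L. F_rational_line F L \<Longrightarrow>
           F_integral_polyhedral_on F (S \<inter> rational_points F \<inter> L) f"
  shows "F_integral_polyhedral_on F (S \<inter> rational_points F) f"
proof -
  interpret subfield_of_reals F by unfold_locales (rule assms(1))
  obtain I where I: "finite I" "I \<subseteq> int_vecs \<times> F" "S = halfspaces_inter I"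
    using F_rational_polyhedral_halfspaces_inter[OF assms(2)] .
  have "integral_system I" using I by (simp add: integral_system_def)
  moreover have "line_polyhedral (halfspaces_inter I) f"
    using F_integral_polyhedral_on_lines[OF assms(3)] I(3) by simp
  ultimately obtain K where K: "integral_system K" "K \<noteq> {}"
    "\<And>x. x \<in> F_vecs \<Longrightarrow> x \<in> S \<Longrightarrow> f x = max_affine K x"
    using line_polyhedral_imp_max_affine unfolding I(3) by metis
  show ?thesis
    unfolding F_integral_polyhedral_on_def
  proof (intro exI conjI ballI)
    let ?\<Lambda> = "(\<lambda>(a, b) x. a \<bullet> x + b) ` K"
    show "finite ?\<Lambda>" "?\<Lambda> \<noteq> {}" using K by (auto simp: integral_system_def)
    show "F_integral_affine F l" if l: "l \<in> ?\<Lambda>" for l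
    proof -
      obtain a b where "(a, b) \<in> K" "l = (\<lambda>x. a \<bullet> x + b)" using l by auto
      then show ?thesis using K(1)
        unfolding F_integral_affine_def integral_system_def rational_points_def by blast
    qed
    show "f x = Max ((\<lambda>l. l x) ` ?\<Lambda>)" if "x \<in> S \<inter> rational_points F" for x
      using K(3)[of x] that by (simp add: max_affine_def image_image case_prod_beta)
  qed
qed

end
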